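(* Let $A,B,C$ be C*-algebras and $\phi\colon A\to C$, $\psi\colon B\to C$ *-homomorphisms with $\phi$ surjective. Let $\mathrm{L}_{A,B}$ be the set of pairs $(I,J)\in\mathrm{Lat}(A)\times\mathrm{Lat}(B)$ such that (1) $\phi(I)=\mathrm{Ideal}(\psi(J))$ and (2) $\mathrm{Ideal}(I\cap\phi^{-1}(\psi(J)))=I$, ordered by $(I_1,J_1)\le(I_2,J_2)$ iff $I_1\subseteq I_2$ and $J_1\subseteq J_2$. Then: (i) $\mathrm{L}_{A,B}$ is a continuous lattice, and the map $\alpha\colon\mathrm{Lat}(A\oplus_C B)\to\mathrm{L}_{A,B}$, $\alpha(M)=(\mathrm{Ideal}(\pi_1(M)),\mathrm{Ideal}(\pi_2(M)))$, is a lattice isomorphism whose inverse is $\beta(I,J)=\{(a,b)\in A\oplus_C B: a\in I,\ b\in J\}$ (the pullback $I\oplus_{\phi(I)}J$ with respect to $\phi|_I\colon I\to\phi(I)$ and $\psi|_J\colon J\to\phi(I)$); (ii) for every subset $T$ of $\mathrm{L}_{A,B}$, the supremum of $T$ in $\mathrm{L}_{A,B}$ equals its supremum in $\mathrm{Lat}(A)\times\mathrm{Lat}(B)$; (iii) $(I_1,J_1)\ll(I_2,J_2)$ in $\mathrm{L}_{A,B}$ if and only if $(I_1,J_1)\ll(I_2,J_2)$ in $\mathrm{Lat}(A)\times\mathrm{Lat}(B)$.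
   Context: $A\oplus_C B=\{(a,b)\in A\oplus B:\phi(a)=\psi(b)\}$ is the pullback, with projections $\pi_1(a,b)=a$, $\pi_2(a,b)=b$. $\mathrm{Lat}(D)$ is the lattice of closed two-sided ideals of $D$; $\mathrm{Ideal}(S)$ is the closed two-sided ideal generated by $S$. In a complete lattice, $x\ll y$ means that for every increasing net $(y_i)$ with $y\le\sup_i y_i$ there is $j$ with $x\le y_j$; a continuous lattice is a complete lattice in which every $x$ equals $\sup\{x':x'\ll x\}$. *)

theory Defs
  imports "HOL-Analysis.Analysis"
begin

class cstar_algebra = real_normed_algebra + banach +
  fixes scaleC :: "complex \<Rightarrow> 'a \<Rightarrow> 'a"
    and star :: "'a \<Rightarrow> 'a"
  assumes scaleC_of_real: "scaleC (complex_of_real r) x = scaleR r x"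
    and scaleC_add_right: "scaleC c (x + y) = scaleC c x + scaleC c y"
    and scaleC_add_left: "scaleC (c + d) x = scaleC c x + scaleC d x"
    and scaleC_scaleC: "scaleC c (scaleC d x) = scaleC (c * d) x"
    and scaleC_one: "scaleC 1 x = x"
    and norm_scaleC: "norm (scaleC c x) = cmod c * norm x"
    and mult_scaleC_left: "scaleC c x * y = scaleC c (x * y)"
    and mult_scaleC_right: "x * scaleC c y = scaleC c (x * y)"
    and star_star: "star (star x) = x"
    and star_add: "star (x + y) = star x + star y"
    and star_scaleC: "star (scaleC c x) = scaleC (cnj c) (star x)"
    and star_mult: "star (x * y) = star y * star x"
    and cstar_identity: "norm (star x * x) = norm x ^ 2"

definition star_hom :: "('a::cstar_algebra \<Rightarrow> 'b::cstar_algebra) \<Rightarrow> bool" where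
  "star_hom f \<longleftrightarrow>
     (\<forall>x y. f (x + y) = f x + f y) \<and>
     (\<forall>c x. f (scaleC c x) = scaleC c (f x)) \<and>
     (\<forall>x y. f (x * y) = f x * f y) \<and>
     (\<forall>x. f (star x) = star (f x))"

definition closed_ideal :: "'a::cstar_algebra set \<Rightarrow> bool" where
  "closed_ideal I \<longleftrightarrow>
     0 \<in> I \<and> (\<forall>x\<in>I. \<forall>y\<in>I. x + y \<in> I) \<and> (\<forall>c. \<forall>x\<in>I. scaleC c x \<in> I) \<and>
     (\<forall>a. \<forall>x\<in>I. a * x \<in> I \<and> x * a \<in> I) \<and> closed I"

definition Lat :: "'a::cstar_algebra set set" where
  "Lat = {I. closed_ideal I}"

definition Ideal :: "'a::cstar_algebra set \<Rightarrow> 'a set" where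
  "Ideal S = \<Inter>{I \<in> Lat. S \<subseteq> I}"

definition pullback :: "('a::cstar_algebra \<Rightarrow> 'c::cstar_algebra) \<Rightarrow> ('b::cstar_algebra \<Rightarrow> 'c)
    \<Rightarrow> ('a \<times> 'b) set" where
  "pullback \<phi> \<psi> = {(a, b). \<phi> a = \<psi> b}"

text \<open>Closed two-sided ideals of the C*-algebra A (+)_C B (operations are
componentwise; its topology is the subspace topology of the product, i.e. of the
max-norm).\<close>
definition pb_closed_ideal :: "('a::cstar_algebra \<Rightarrow> 'c::cstar_algebra) \<Rightarrow> ('b::cstar_algebra \<Rightarrow> 'c)
    \<Rightarrow> ('a \<times> 'b) set \<Rightarrow> bool" where
  "pb_closed_ideal \<phi> \<psi> M \<longleftrightarrow>
     M \<subseteq> pullback \<phi> \<psi> \<and> (0, 0) \<in> M \<and>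
     (\<forall>(x1, x2)\<in>M. \<forall>(y1, y2)\<in>M. (x1 + y1, x2 + y2) \<in> M) \<and>
     (\<forall>c. \<forall>(x1, x2)\<in>M. (scaleC c x1, scaleC c x2) \<in> M) \<and>
     (\<forall>(d1, d2)\<in>pullback \<phi> \<psi>. \<forall>(x1, x2)\<in>M.
         (d1 * x1, d2 * x2) \<in> M \<and> (x1 * d1, x2 * d2) \<in> M) \<and>
     closedin (top_of_set (pullback \<phi> \<psi>)) M"

definition Lat_pb :: "('a::cstar_algebra \<Rightarrow> 'c::cstar_algebra) \<Rightarrow> ('b::cstar_algebra \<Rightarrow> 'c)
    \<Rightarrow> ('a \<times> 'b) set set" where
  "Lat_pb \<phi> \<psi> = {M. pb_closed_ideal \<phi> \<psi> M}"

definition L_AB :: "('a::cstar_algebra \<Rightarrow> 'c::cstar_algebra) \<Rightarrow> ('b::cstar_algebra \<Rightarrow> 'c)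
    \<Rightarrow> ('a set \<times> 'b set) set" where
  "L_AB \<phi> \<psi> = {(I, J). I \<in> Lat \<and> J \<in> Lat \<and>
       \<phi> ` I = Ideal (\<psi> ` J) \<and> Ideal (I \<inter> \<phi> -` (\<psi> ` J)) = I}"

definition pair_le :: "'a set \<times> 'b set \<Rightarrow> 'a set \<times> 'b set \<Rightarrow> bool" where
  "pair_le p q \<longleftrightarrow> fst p \<subseteq> fst q \<and> snd p \<subseteq> snd q"

definition is_lub :: "('x \<Rightarrow> 'x \<Rightarrow> bool) \<Rightarrow> 'x set \<Rightarrow> 'x set \<Rightarrow> 'x \<Rightarrow> bool" where
  "is_lub le S T s \<longleftrightarrow> s \<in> S \<and> (\<forall>t\<in>T. le t s) \<and>
     (\<forall>u\<in>S. (\<forall>t\<in>T. le t u) \<longrightarrow> le s u)"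

definition partial_order_on_set :: "('x \<Rightarrow> 'x \<Rightarrow> bool) \<Rightarrow> 'x set \<Rightarrow> bool" where
  "partial_order_on_set le S \<longleftrightarrow>
     (\<forall>x\<in>S. le x x) \<and> (\<forall>x\<in>S. \<forall>y\<in>S. le x y \<and> le y x \<longrightarrow> x = y) \<and>
     (\<forall>x\<in>S. \<forall>y\<in>S. \<forall>z\<in>S. le x y \<and> le y z \<longrightarrow> le x z)"

definition complete_lattice_on :: "('x \<Rightarrow> 'x \<Rightarrow> bool) \<Rightarrow> 'x set \<Rightarrow> bool" where
  "complete_lattice_on le S \<longleftrightarrow> partial_order_on_set le S \<and>
     (\<forall>T\<subseteq>S. \<exists>s. is_lub le S T s)"

definition directed_on :: "'i set \<Rightarrow> ('i \<Rightarrow> 'i \<Rightarrow> bool) \<Rightarrow> bool" where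
  "directed_on J r \<longleftrightarrow> J \<noteq> {} \<and> (\<forall>i\<in>J. r i i) \<and>
     (\<forall>i\<in>J. \<forall>j\<in>J. \<forall>k\<in>J. r i j \<and> r j k \<longrightarrow> r i k) \<and>
     (\<forall>i\<in>J. \<forall>j\<in>J. \<exists>k\<in>J. r i k \<and> r j k)"

text \<open>Way-below relation: for every increasing net (y_i) in S (indexed by a
directed set, here taken with index type equal to the element type) with
y below its supremum, x is below some y_j.\<close>
definition way_below :: "('x \<Rightarrow> 'x \<Rightarrow> bool) \<Rightarrow> 'x set \<Rightarrow> 'x \<Rightarrow> 'x \<Rightarrow> bool" where
  "way_below le S x y \<longleftrightarrow>
     (\<forall>(J :: 'x set) r (f :: 'x \<Rightarrow> 'x).
        directed_on J r \<and> f ` J \<subseteq> S \<and> (\<forall>i\<in>J. \<forall>j\<in>J. r i j \<longrightarrow> le (f i) (f j)) \<and>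
        (\<exists>s. is_lub le S (f ` J) s \<and> le y s)
        \<longrightarrow> (\<exists>j\<in>J. le x (f j)))"

definition continuous_lattice :: "('x \<Rightarrow> 'x \<Rightarrow> bool) \<Rightarrow> 'x set \<Rightarrow> bool" where
  "continuous_lattice le S \<longleftrightarrow> complete_lattice_on le S \<and>
     (\<forall>x\<in>S. is_lub le S {x'\<in>S. way_below le S x' x} x)"

definition lattice_iso :: "('x \<Rightarrow> 'x \<Rightarrow> bool) \<Rightarrow> 'x set \<Rightarrow> ('y \<Rightarrow> 'y \<Rightarrow> bool) \<Rightarrow> 'y set
    \<Rightarrow> ('x \<Rightarrow> 'y) \<Rightarrow> bool" where
  "lattice_iso le1 S1 le2 S2 f \<longleftrightarrow> bij_betw f S1 S2 \<and>
     (\<forall>x\<in>S1. \<forall>y\<in>S1. le1 x y \<longleftrightarrow> le2 (f x) (f y))"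

end

theory Submission
  imports Defs "HOL-Complex_Analysis.Complex_Analysis"
begin

text \<open>
  Polynomials in a self-adjoint \<open>h\<close> with \<open>norm h < R\<close> are bounded by their supremum on \<open>[-R, R]\<close>: writing
  \<open>h = R (u + u\<^sup>*) / 2\<close> with \<open>u = h/R + i sqrt (1 - (h/R)\<^sup>2)\<close> acting as a surjective isometry, a polynomial
  in \<open>h\<close> becomes a Laurent polynomial in \<open>u\<close>, whose coefficients Cauchy's inequality controls, and the
  C*-identity removes the resulting degree factor. This yields a functional calculus and hence closed
  images of *-subalgebras, self-adjointness of closed ideals \<open>D\<close>, and \<open>D = closure (D D D)\<close>.

  If \<open>M\<close> is a closed ideal of the pullback, its projection to \<open>B\<close> is a closed ideal, so an element of
  \<open>\<beta> (\<alpha> M)\<close> differs from one of \<open>M\<close> by some \<open>(x, 0)\<close> with \<open>x\<close> in \<open>D = Ideal (\<pi>\<^sub>1 M) \<inter> ker \<phi>\<close>; since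
  \<open>(u, 0) M (w, 0) \<subseteq> M\<close> for \<open>u, w\<close> in the kernel, \<open>D D D\<close> and hence \<open>D\<close> is contained in \<open>M\<close>. For the
  way-below relation, let \<open>f\<close> vanish on \<open>[-\<delta>, \<delta>]\<close> and be \<open>\<delta>\<close>-close to the identity: for self-adjoint
  \<open>(a, b)\<close> in \<open>M\<close> the pair generated by \<open>(f a, f b)\<close> lies in \<open>L_AB\<close> and is way below \<open>\<alpha> M\<close> already in
  \<open>Lat \<times> Lat\<close>, and these pairs generate \<open>\<alpha> M\<close>.
\<close>

section \<open>Elementary identities\<close>

lemma scaleC_zero_left [simp]: "scaleC 0 x = (0::'a::cstar_algebra)"
  by (metis scaleC_of_real of_real_0 scaleR_zero_left)

lemma scaleC_zero_right [simp]: "scaleC c 0 = (0::'a::cstar_algebra)"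
  by (metis norm_scaleC norm_zero mult_zero_right norm_eq_zero)

lemma scaleC_minus_left: "scaleC (- c) x = - scaleC c (x::'a::cstar_algebra)"
  by (metis add.right_inverse neg_eq_iff_add_eq_0 scaleC_add_left scaleC_zero_left)

lemma scaleC_minus_right: "scaleC c (- x) = - scaleC c (x::'a::cstar_algebra)"
  by (metis add.right_inverse neg_eq_iff_add_eq_0 scaleC_add_right scaleC_zero_right)

lemma scaleC_diff_right: "scaleC c (x - y) = scaleC c x - scaleC c (y::'a::cstar_algebra)"
  by (metis add_uminus_conv_diff scaleC_add_right scaleC_minus_right)

lemma scaleC_minus_one: "scaleC (- 1) x = - (x::'a::cstar_algebra)"
  by (simp add: scaleC_minus_left scaleC_one)

lemma scaleC_scaleR: "scaleC c (r *\<^sub>R x) = r *\<^sub>R scaleC c (x::'a::cstar_algebra)"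
  by (metis mult.commute scaleC_of_real scaleC_scaleC)

lemma star_zero [simp]: "star 0 = (0::'a::cstar_algebra)"
  by (metis add_cancel_right_right star_add)

lemma star_minus: "star (- x) = - star (x::'a::cstar_algebra)"
  by (metis add.right_inverse neg_eq_iff_add_eq_0 star_add star_zero)

lemma star_diff: "star (x - y) = star x - star (y::'a::cstar_algebra)"
  by (metis add_uminus_conv_diff star_add star_minus)

lemma star_scaleR: "star (r *\<^sub>R x) = r *\<^sub>R star (x::'a::cstar_algebra)"
  by (metis complex_cnj_complex_of_real scaleC_of_real star_scaleC)

text \<open>The C*-identity bounds \<open>norm y\<close> by \<open>norm (star y)\<close>; applying
  this to \<open>x\<close> and to \<open>star x\<close> gives equality.\<close>

lemma norm_star [simp]: "norm (star x) = norm (x::'a::cstar_algebra)"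
proof -
  have le: "norm y \<le> norm (star y)" for y :: 'a
  proof (cases "y = 0")
    case False
    have "norm y * norm y \<le> norm (star y) * norm y"
      by (metis cstar_identity norm_mult_ineq power2_eq_square)
    with False show ?thesis by simp
  qed simp
  show ?thesis using le[of x] le[of "star x"] by (simp add: star_star)
qed

lemma norm_mult_self_adjoint: "star a = a \<Longrightarrow> norm (a * a) = norm (a::'a::cstar_algebra) ^ 2"
  using cstar_identity[of a] by simp

section \<open>Polynomials in an operator\<close>

text \<open>An algebra here need not have a unit, so a constant term makes sense only as an
  operator. With \<open>T\<close> left multiplication by \<open>h\<close>, this is the element p(h)
  x, where p(h) is formed in the unitization.\<close>

definition poly_op :: "real poly \<Rightarrow> ('a::real_vector \<Rightarrow> 'a) \<Rightarrow> 'a \<Rightarrow> 'a" where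
  "poly_op p T x = (\<Sum>i\<le>degree p. coeff p i *\<^sub>R (T ^^ i) x)"

lemma poly_op_altdef:
  assumes "degree p \<le> n"
  shows "poly_op p T x = (\<Sum>i\<le>n. coeff p i *\<^sub>R (T ^^ i) x)"
  unfolding poly_op_def using assms
  by (intro sum.mono_neutral_left) (auto simp: coeff_eq_0)

lemma poly_op_0 [simp]: "poly_op 0 T x = 0"
  by (simp add: poly_op_def)

lemma poly_op_pCons:
  assumes "linear T"
  shows "poly_op (pCons a p) T x = a *\<^sub>R x + T (poly_op p T x)"
proof -
  interpret linear T by fact
  have "poly_op (pCons a p) T x = (\<Sum>i\<le>Suc (degree p). coeff (pCons a p) i *\<^sub>R (T ^^ i) x)"
    by (rule poly_op_altdef) (rule degree_pCons_le)
  also have "\<dots> = a *\<^sub>R x + (\<Sum>i\<le>degree p. coeff p i *\<^sub>R T ((T ^^ i) x))"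
    by (simp add: sum.atMost_Suc_shift del: sum.atMost_Suc)
  also have "(\<Sum>i\<le>degree p. coeff p i *\<^sub>R T ((T ^^ i) x)) = T (poly_op p T x)"
    by (simp add: poly_op_def sum scaleR)
  finally show ?thesis .
qed

lemma poly_op_add: "poly_op (p + q) T x = poly_op p T x + poly_op q T x"
  using poly_op_altdef[of p "max (degree p) (degree q)" T x]
    poly_op_altdef[of q "max (degree p) (degree q)" T x]
    poly_op_altdef[of "p + q" "max (degree p) (degree q)" T x]
  by (simp add: degree_add_le_max sum.distrib scaleR_left_distrib)

lemma poly_op_smult: "poly_op (smult a p) T x = a *\<^sub>R poly_op p T x"
  using poly_op_altdef[of "smult a p" "degree p" T x]
  by (simp add: degree_smult_le poly_op_def scaleR_sum_right)

lemma poly_op_diff: "poly_op (p - q) T x = poly_op p T x - poly_op q T x"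
  using poly_op_add[of p "smult (-1) q" T x] poly_op_smult[of "-1" q T x] by simp

lemma poly_op_1 [simp]: "poly_op 1 T x = x"
  by (simp add: poly_op_def)

lemma poly_op_mult:
  assumes "linear T"
  shows "poly_op (p * q) T x = poly_op p T (poly_op q T x)"
  by (induction p) (simp_all add: poly_op_pCons[OF assms] poly_op_add poly_op_smult)

lemma poly_op_commute:
  assumes "linear T" "linear S" "\<And>x. S (T x) = T (S x)"
  shows "S (poly_op p T x) = poly_op p T (S x)"
  using assms(3) linear_0[OF assms(2)]
  by (induction p)
    (simp_all add: poly_op_pCons[OF assms(1)] linear_add[OF assms(2)] linear_scale[OF assms(2)])

lemma linear_mult_left: "linear ((*) (h::'a::real_algebra))"
  by (rule linearI) (simp_all add: distrib_left)

lemma poly_op_mult_right: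
  fixes h x y :: "'a::real_algebra"
  shows "poly_op p ((*) h) (x * y) = poly_op p ((*) h) x * y"
  by (induction p)
    (simp_all add: poly_op_pCons[OF linear_mult_left] distrib_right mult.assoc)

text \<open>Left multiplication by a self-adjoint \<open>h\<close> is symmetric for the
  algebra-valued inner product \<open>star x * y\<close>, and so is every polynomial in it with real
  coefficients.\<close>

lemma poly_op_symmetric:
  fixes h x y :: "'a::cstar_algebra"
  assumes "star h = h"
  shows "star (poly_op p ((*) h) x) * y = star x * poly_op p ((*) h) y"
proof (induction p arbitrary: x y)
  case (pCons a p)
  have "star (poly_op p ((*) h) x) * (h * y) = star x * (h * poly_op p ((*) h) y)"
    using pCons.IH[of x "h * y"] poly_op_commute[OF linear_mult_left linear_mult_left, of h h p y]
    by simp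
  then show ?case
    by (simp add: poly_op_pCons[OF linear_mult_left] distrib_right distrib_left
        star_add star_scaleR star_mult assms mult.assoc)
qed simp

text \<open>Cauchy's inequality on the unit circle, since the \<open>n\<close>-th derivative at 0 is
  \<open>fact n * coeff p n\<close>.\<close>

lemma norm_coeff_le:
  fixes p :: "complex poly"
  assumes "\<And>z. norm z = 1 \<Longrightarrow> norm (poly p z) \<le> B"
  shows "norm (coeff p n) \<le> B"
proof -
  have d: "(deriv ^^ n) (poly p) = poly ((pderiv ^^ n) p)" for p :: "complex poly"
  proof (induction n)
    case (Suc n)
    have "deriv (poly q) = poly (pderiv q)" for q :: "complex poly"
      by (rule ext, rule DERIV_imp_deriv, rule poly_DERIV)
    with Suc show ?case by simp
  qed simp
  have "norm ((deriv ^^ n) (poly p) 0) \<le> fact n * B / 1 ^ n"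
    by (rule Cauchy_inequality) (auto intro!: holomorphic_intros continuous_intros assms)
  moreover have "(deriv ^^ n) (poly p) 0 = fact n * coeff p n"
    unfolding d by (simp add: poly_0_coeff_0 coeff_higher_pderiv pochhammer_fact)
  ultimately have "fact n * norm (coeff p n) \<le> fact n * B"
    by (simp add: norm_mult)
  then show ?thesis by simp
qed

section \<open>The norm bound for polynomials in a self-adjoint element\<close>

lemma bounded_linear_star: "bounded_linear (star :: 'a::cstar_algebra \<Rightarrow> 'a)"
  by (rule bounded_linear_intro[where K=1]) (simp_all add: star_add star_scaleR)

text \<open>The solution \<open>y\<close> is \<open>1 - sqrt (1 - h\<^sup>2)\<close>, which lies in the algebra even when it has no unit.\<close>

lemma one_minus_sqrt_exists:
  fixes h :: "'a::cstar_algebra"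
  assumes "star h = h" "norm h < 1"
  obtains y where "star y = y" "y * h = h * y" "h * h + y * y = 2 *\<^sub>R y"
proof -
  define r where "r = norm (h * h)"
  have r: "0 \<le> r" "r < 1"
    using assms by (auto simp: r_def norm_mult_self_adjoint power_less_one_iff)
  define S where "S = {y. norm y \<le> r \<and> star y = y \<and> y * h = h * y}"
  \<comment> \<open>Fixed points of \<open>F\<close> are the solutions of the quadratic equation.
    \<open>F\<close> contracts the complete set \<open>S\<close> with constant \<open>r\<close>, so
    the fixed point also satisfies the conditions defining \<open>S\<close>.\<close>
  define F where "F y = (1/2) *\<^sub>R (h * h + y * y)" for y
  have cont: "continuous_on UNIV (star :: 'a \<Rightarrow> 'a)"
    by (rule linear_continuous_on[OF bounded_linear_star])
  have "closed S"
    unfolding S_def by (intro closed_Collect_conj closed_Collect_le closed_Collect_eq continuous_intros cont)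
  then have "complete S" by (simp add: complete_eq_closed)
  moreover have "S \<noteq> {}" using r by (auto simp: S_def intro!: exI[of _ 0])
  moreover have "F ` S \<subseteq> S"
  proof safe
    fix y assume y: "y \<in> S"
    then have n: "norm (y * y) \<le> r * r"
      by (intro order_trans[OF norm_mult_ineq] mult_mono) (use r in \<open>auto simp: S_def\<close>)
    have "r * r \<le> r" using r by (simp add: mult_left_le)
    then have "norm (F y) \<le> r"
      using norm_triangle_ineq[of "h * h" "y * y"] n by (simp add: F_def r_def[symmetric])
    moreover have "star (F y) = F y"
      using y assms by (simp add: F_def S_def star_scaleR star_add star_mult)
    moreover have "y * y * h = h * (y * y)"
      using y by (metis (mono_tags, lifting) S_def mem_Collect_eq mult.assoc)
    then have "F y * h = h * F y"
      by (simp add: F_def distrib_left distrib_right mult.assoc)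
    ultimately show "F y \<in> S" by (simp add: S_def)
  qed
  moreover have "dist (F x) (F y) \<le> r * dist x y" if "x \<in> S" "y \<in> S" for x y
  proof -
    have "F x - F y = (1/2) *\<^sub>R (x * (x - y) + (x - y) * y)"
      by (simp add: F_def algebra_simps)
    moreover have "norm (x * (x - y)) \<le> r * norm (x - y)"
      using that by (intro order_trans[OF norm_mult_ineq] mult_right_mono) (auto simp: S_def)
    moreover have "norm ((x - y) * y) \<le> norm (x - y) * r"
      using that by (intro order_trans[OF norm_mult_ineq] mult_left_mono) (auto simp: S_def)
    ultimately show ?thesis
      using norm_triangle_ineq[of "x * (x - y)" "(x - y) * y"]
      by (simp add: dist_norm mult.commute)
  qed
  ultimately have "\<exists>!y\<in>S. F y = y"
    by (intro Banach_fix[of S r F] r)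
  then obtain y where "y \<in> S" "F y = y" by blast
  then have "2 *\<^sub>R ((1/2) *\<^sub>R (h * h + y * y)) = 2 *\<^sub>R y"
    by (simp only: F_def)
  then have "h * h + y * y = 2 *\<^sub>R y" by simp
  with \<open>y \<in> S\<close> show ?thesis using that by (auto simp: S_def)
qed

text \<open>With s = 1 - y in the unitization, the last equation reads h^2 + s^2 = 1. The conditions
  are algebraic, hence preserved by *-homomorphisms.\<close>

locale sqrt_pair =
  fixes h y :: "'a::cstar_algebra"
  assumes star_h: "star h = h" and star_y: "star y = y"
    and yh: "y * h = h * y" and hh: "h * h + y * y = 2 *\<^sub>R y"
begin

text \<open>Left multiplication by h + c (1 - y) in the unitization; for \<open>c\<close> equal to
  \<open>\<i>\<close> or \<open>- \<i>\<close> this element is unitary.\<close>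

definition U :: "complex \<Rightarrow> 'a \<Rightarrow> 'a" where
  "U c x = h * x + scaleC c (x - y * x)"

lemma yhx: "y * (h * x) = h * (y * x)"
  by (metis mult.assoc yh)

lemma yyx: "y * (y * x) = y * x + y * x - h * (h * x)"
proof -
  have "(h * h + y * y) * x = (2 *\<^sub>R y) * x" by (simp only: hh)
  then have "h * (h * x) + y * (y * x) = y * x + y * x"
    by (simp add: distrib_right mult.assoc scaleR_2)
  then show ?thesis by (simp add: algebra_simps)
qed

lemma linear_U: "linear (U c)"
  by (rule linearI)
    (simp_all add: U_def ring_distribs scaleR_right_distrib scaleR_right_diff_distrib scaleC_add_right scaleC_diff_right scaleC_scaleR)

text \<open>Here \<open>c\<close> is \<open>\<i>\<close> or \<open>- \<i>\<close>: the cross terms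
  in \<open>star (U c x) * U c x\<close> cancel, and h^2 + (1 - y)^2 = 1 leaves
  \<open>star x * x\<close>.\<close>

lemma norm_U:
  assumes "cnj c = - c" "c * c = - 1"
  shows "norm (U c x) = norm x"
proof -
  have "star (U c x) * U c x = star x * x"
    using assms
    by (simp add: U_def star_add star_mult star_diff star_scaleC star_h star_y ring_distribs mult.assoc
        mult_scaleC_left mult_scaleC_right scaleC_scaleC scaleC_diff_right scaleC_minus_left
        scaleC_one scaleC_add_right yhx yyx)
  then show ?thesis
    by (metis cstar_identity norm_ge_zero power2_eq_imp_eq)
qed

lemma U_inverse:
  assumes "c * c = - 1"
  shows "U (- c) (U c x) = x"
  using assms
  by (simp add: U_def ring_distribs mult_scaleC_right scaleC_add_right scaleC_scaleC
      scaleC_diff_right scaleC_minus_left scaleC_one yhx yyx)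

lemma U_add: "U c x + U (- c) x = 2 *\<^sub>R (h * x)"
  by (simp add: U_def scaleC_minus_left scaleR_2)

lemma U_commute: "h * U c x = U c (h * x)"
  by (simp add: U_def ring_distribs mult_scaleC_right yhx)

text \<open>\<open>h * x\<close> is the mean of the two isometric images \<open>U \<i> x\<close> and
  \<open>U (- \<i>) x\<close>.\<close>

lemma norm_mult_le: "norm (h * x) \<le> norm x"
  using norm_triangle_ineq[of "U \<i> x" "U (- \<i>) x"] norm_U[of \<i> x] norm_U[of "- \<i>" x]
  by (simp add: U_add)

lemma norm_le_one: "norm h \<le> 1"
proof (cases "h = 0")
  case False
  have "norm h * norm h \<le> norm h"
    using norm_mult_le[of h] star_h by (simp add: norm_mult_self_adjoint power2_eq_square)
  with False show ?thesis by simp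
qed simp

end

section \<open>Contractivity of *-homomorphisms\<close>

lemma star_homD:
  assumes "star_hom f"
  shows "f (x + y) = f x + f y" "f (scaleC c x) = scaleC c (f x)" "f (x * y) = f x * f y"
    "f (star x) = star (f x)" "f 0 = 0" "f (r *\<^sub>R x) = r *\<^sub>R f x" "f (- x) = - f x"
    "f (x - y) = f x - f y"
proof -
  show *: "f (x + y) = f x + f y" "f (scaleC c x) = scaleC c (f x)" "f (x * y) = f x * f y"
    "f (star x) = star (f x)" for x y c
    using assms by (auto simp: star_hom_def)
  show "f 0 = 0" using *(1)[of 0 0] by simp
  show "f (r *\<^sub>R x) = r *\<^sub>R f x" by (metis *(2) scaleC_of_real)
  show m: "f (- x) = - f x" for x by (metis *(2) scaleC_minus_one)
  show "f (x - y) = f x - f y" using *(1)[of x "- y"] by (simp add: m)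
qed

text \<open>A *-homomorphism carries the pair of \<open>one_minus_sqrt_exists\<close> to a
  \<open>sqrt_pair\<close>, so self-adjoint elements of norm below 1 have images of norm at most 1.
  Scaling and the C*-identity give the general case; continuity of \<open>f\<close> is a
  consequence, not an assumption.\<close>

lemma star_hom_norm_le:
  fixes f :: "'a::cstar_algebra \<Rightarrow> 'b::cstar_algebra"
  assumes f: "star_hom f"
  shows "norm (f x) \<le> norm x"
proof -
  note fs = star_homD[OF f]
  have one: "norm (f h) \<le> 1" if h: "star h = h" "norm h < 1" for h
  proof -
    obtain y where y: "star y = y" "y * h = h * y" "h * h + y * y = 2 *\<^sub>R y"
      by (rule one_minus_sqrt_exists[OF h])
    have "sqrt_pair (f h) (f y)"
    proof
      show "star (f h) = f h" "star (f y) = f y" using h y by (simp_all flip: fs(4))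
      show "f y * f h = f h * f y" using y by (simp flip: fs(3))
      have "f (h * h + y * y) = f (2 *\<^sub>R y)" using y by simp
      then show "f h * f h + f y * f y = 2 *\<^sub>R f y" by (simp only: fs)
    qed
    then show ?thesis by (rule sqrt_pair.norm_le_one)
  qed
  have sa: "norm (f h) \<le> norm h" if h: "star h = h" for h
  proof (rule field_le_epsilon)
    fix e :: real assume e: "0 < e"
    define r where "r = norm h + e"
    have r: "r > 0" "norm h < r" using e by (auto simp: r_def add_nonneg_pos)
    have "norm (f ((1/r) *\<^sub>R h)) \<le> 1"
      by (rule one) (use r h in \<open>auto simp: star_scaleR\<close>)
    with r show "norm (f h) \<le> norm h + e" by (simp add: fs r_def[symmetric] divide_le_eq)
  qed
  have "norm (f x) ^ 2 \<le> norm x ^ 2"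
    using sa[of "star x * x"] by (simp add: fs cstar_identity star_mult star_star)
  then show ?thesis by (simp add: power2_le_iff_abs_le)
qed

lemma star_hom_bounded_linear:
  assumes "star_hom f" shows "bounded_linear f"
  by (rule bounded_linear_intro[where K=1])
    (use star_hom_norm_le[OF assms] in \<open>simp_all add: star_homD[OF assms]\<close>)

section \<open>Laurent substitution and the bound for polynomials\<close>

lemma map_poly_of_real_add:
  "map_poly of_real (p + q) = (map_poly of_real p + map_poly of_real q :: 'a::real_algebra_1 poly)"
  by (rule poly_eqI) (simp add: coeff_map_poly)

lemma poly_map_poly_of_real:
  "poly (map_poly of_real p) (of_real t :: 'a::{real_algebra_1,comm_ring_1}) = of_real (poly p t)"
  by (induction p) (simp_all add: map_poly_pCons)

lemma norm_poly_op_le_sum: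
  fixes T :: "'a::real_normed_vector \<Rightarrow> 'a"
  assumes "\<And>x. norm (T x) = norm x" "\<And>i. \<bar>coeff q i\<bar> \<le> M" "degree q \<le> n"
  shows "norm (poly_op q T x) \<le> real (Suc n) * M * norm x"
proof -
  have T: "norm ((T ^^ i) x) = norm x" for i
    by (induction i) (simp_all add: assms(1))
  have "norm (poly_op q T x) \<le> (\<Sum>i\<le>n. norm (coeff q i *\<^sub>R (T ^^ i) x))"
    unfolding poly_op_altdef[OF assms(3)] by (rule norm_sum)
  also have "\<dots> \<le> (\<Sum>i\<le>n. M * norm x)"
    by (intro sum_mono) (simp add: T mult_right_mono assms(2))
  finally show ?thesis by (simp add: mult.assoc)
qed

text \<open>Substituting \<open>h = R (u + u\<^sup>-\<^sup>1) / 2\<close> turns a polynomial in \<open>h\<close> into a Laurent polynomial in \<open>u\<close>.\<close>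

lemma poly_op_laurent:
  fixes U H :: "'a::real_vector \<Rightarrow> 'a"
  assumes "linear U" "linear H" and comm: "\<And>x. U (H x) = H (U x)"
    and HU: "\<And>x. H (U x) = (R/2) *\<^sub>R (U (U x) + x)"
  shows "\<exists>q d. d \<le> degree P \<and> degree q \<le> 2 * degree P \<and>
     (\<forall>x. poly_op q U x = (U ^^ d) (poly_op P H x)) \<and>
     (\<forall>z::complex. z \<noteq> 0 \<longrightarrow>
        poly (map_poly of_real q) z = z ^ d * poly (map_poly of_real P) (of_real (R/2) * (z + 1/z)))"
proof (induction P)
  case 0
  show ?case
    using linear_0[OF assms(1)] by (intro exI[of _ 0]) simp
next
  case (pCons a P)
  show ?case
  \<comment> \<open>\<open>pCons a P\<close> has larger degree than \<open>P\<close> only when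
    \<open>P\<close> is nonzero; for \<open>P = 0\<close> the exponent \<open>d\<close> must stay
    0.\<close>
  proof (cases "P = 0")
    case True
    then show ?thesis
      using linear_0[OF assms(2)]
      by (intro exI[of _ "[:a:]"] exI[of _ 0])
        (simp add: poly_op_pCons[OF assms(1)] poly_op_pCons[OF assms(2)] linear_0[OF assms(1)]
          map_poly_pCons)
  next
    case False
    from pCons.IH obtain q d where IH: "d \<le> degree P" "degree q \<le> 2 * degree P"
      "\<And>x. poly_op q U x = (U ^^ d) (poly_op P H x)"
      "\<And>z::complex. z \<noteq> 0 \<Longrightarrow>
        poly (map_poly of_real q) z = z ^ d * poly (map_poly of_real P) (of_real (R/2) * (z + 1/z))"
      by blast
    have linU: "linear (U ^^ n)" for n
    proof (induction n)
      case (Suc n)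
      show ?case
        by (rule linearI) (simp_all add: linear_add[OF Suc] linear_scale[OF Suc]
            linear_add[OF assms(1)] linear_scale[OF assms(1)])
    qed (simp add: linearI)
    have cU: "(U ^^ n) (H x) = H ((U ^^ n) x)" for n x
      by (induction n) (simp_all add: comm)
    \<comment> \<open>Let w = (R/2) (z + 1/z). Multiplying a + w P(w) by z^(d+1) gives a z^(d+1) +
      (R/2) (1 + z^2) q(z).\<close>
    define q' where "q' = monom a (Suc d) + smult (R/2) (q + pCons 0 (pCons 0 q))"
    have "degree q' \<le> 2 * degree (pCons a P)"
      unfolding q'_def
    proof (rule degree_add_le)
      show "degree (monom a (Suc d)) \<le> 2 * degree (pCons a P)"
        using IH(1) False by (intro order_trans[OF degree_monom_le]) simp
      have "degree (pCons 0 (pCons 0 q)) \<le> 2 * degree (pCons a P)"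
        using IH(2) False degree_pCons_le[of 0 "pCons 0 q"] degree_pCons_le[of 0 q] by simp
      then show "degree (smult (R/2) (q + pCons 0 (pCons 0 q))) \<le> 2 * degree (pCons a P)"
        using IH(2) False
        by (intro order_trans[OF degree_smult_le] degree_add_le) simp_all
    qed
    moreover have "poly_op q' U x = (U ^^ Suc d) (poly_op (pCons a P) H x)" for x
    proof -
      have mon: "poly_op (monom a n) U x = a *\<^sub>R (U ^^ n) x" for n
        by (induction n) (simp_all add: monom_0 monom_Suc poly_op_pCons[OF assms(1)]
            linear_0[OF assms(1)] linear_scale[OF assms(1)])
      have "poly_op q' U x = a *\<^sub>R (U ^^ Suc d) x + H (U (poly_op q U x))"
        by (simp add: q'_def poly_op_add poly_op_smult mon poly_op_pCons[OF assms(1)] HU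
            add.commute)
      also have "\<dots> = (U ^^ Suc d) (poly_op (pCons a P) H x)"
        by (simp add: poly_op_pCons[OF assms(2)] linear_add[OF linU] linear_scale[OF linU]
            linear_add[OF assms(1)] linear_scale[OF assms(1)] IH(3) cU comm)
      finally show ?thesis .
    qed
    moreover have "poly (map_poly of_real q') z
        = z ^ Suc d * poly (map_poly of_real (pCons a P)) (of_real (R/2) * (z + 1/z))"
      if "z \<noteq> 0" for z :: complex
    proof -
      have "poly (map_poly of_real q') z = of_real a * z ^ Suc d
          + of_real (R/2) * (1 + z * z) * poly (map_poly of_real q) z"
        by (simp add: q'_def map_poly_of_real_add map_poly_smult map_poly_monom map_poly_pCons
            poly_monom ring_distribs mult.assoc)
      also have "\<dots> = z ^ Suc d * poly (map_poly of_real (pCons a P)) (of_real (R/2) * (z + 1/z))"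
        using that by (simp add: IH(4) map_poly_pCons field_simps)
      finally show ?thesis .
    qed
    ultimately show ?thesis
      using IH(1) False by (intro exI[of _ q'] exI[of _ "Suc d"]) simp
  qed
qed

text \<open>On the unit circle z + 1/z = 2 Re z, so the polynomial \<open>q\<close> of
  \<open>poly_op_laurent\<close> is bounded there by \<open>M\<close>, and so are its coefficients.
  \<open>U \<i>\<close> is isometric, and at most \<open>2 * degree P + 1\<close> terms are
  summed.\<close>

lemma norm_poly_op_le_degree:
  fixes h :: "'a::cstar_algebra"
  assumes h: "star h = h" "norm h < R" and M: "\<And>t. \<bar>t\<bar> \<le> R \<Longrightarrow> \<bar>poly P t\<bar> \<le> M"
  shows "norm (poly_op P ((*) h) x) \<le> real (Suc (2 * degree P)) * M * norm x"
proof -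
  have R: "R > 0" using h(2) norm_ge_zero[of h] by linarith
  obtain y where y: "star y = y" "y * ((1/R) *\<^sub>R h) = ((1/R) *\<^sub>R h) * y"
    "((1/R) *\<^sub>R h) * ((1/R) *\<^sub>R h) + y * y = 2 *\<^sub>R y"
    by (rule one_minus_sqrt_exists[of "(1/R) *\<^sub>R h"]) (use h R in \<open>auto simp: star_scaleR\<close>)
  interpret sqrt_pair "(1/R) *\<^sub>R h" y
    by unfold_locales (use h y in \<open>simp_all add: star_scaleR\<close>)
  have hU: "h * U \<i> x = (R/2) *\<^sub>R (U \<i> (U \<i> x) + x)" for x
    using U_add[of \<i> "U \<i> x"] U_inverse[of \<i> x] R by simp
  have comm: "U \<i> (h * x) = h * U \<i> x" for x
    using U_commute[of \<i> x] R by (simp add: linear_scale[OF linear_U])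
  obtain q d where q: "d \<le> degree P" "degree q \<le> 2 * degree P"
     "\<And>x. poly_op q (U \<i>) x = (U \<i> ^^ d) (poly_op P ((*) h) x)"
     "\<And>z::complex. z \<noteq> 0 \<Longrightarrow> poly (map_poly of_real q) z
         = z ^ d * poly (map_poly of_real P) (of_real (R/2) * (z + 1/z))"
    using poly_op_laurent[OF linear_U linear_mult_left comm hU, of P] by blast
  have "\<bar>coeff q i\<bar> \<le> M" for i
  proof -
    have "norm (poly (map_poly of_real q) z) \<le> M" if z: "norm z = 1" for z :: complex
    proof -
      have z0: "z \<noteq> 0" using z by auto
      have "z + 1/z = of_real (2 * Re z)"
      proof -
        have "z * cnj z = 1" using z by (simp add: complex_norm_square[symmetric])
        then have "1 / z = cnj z" using z0 by (simp add: field_simps)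
        then show ?thesis by (simp add: complex_add_cnj)
      qed
      then have "of_real (R/2) * (z + 1/z) = (of_real (R * Re z) :: complex)"
        by simp
      then have "norm (poly (map_poly of_real q) z) = \<bar>poly P (R * Re z)\<bar>"
        using z q(4)[OF z0] by (auto simp: norm_mult norm_power poly_map_poly_of_real simp del: of_real_mult)
      moreover have "\<bar>R * Re z\<bar> \<le> R"
        using abs_Re_le_cmod[of z] z R by (simp add: abs_mult)
      ultimately show ?thesis using M by simp
    qed
    then have "norm (coeff (map_poly of_real q :: complex poly) i) \<le> M"
      by (rule norm_coeff_le)
    then show ?thesis by (simp add: coeff_map_poly)
  qed
  then have "norm (poly_op q (U \<i>) x) \<le> real (Suc (2 * degree P)) * M * norm x"
    by (intro norm_poly_op_le_sum norm_U q(2)) simp_all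
  moreover have "norm ((U \<i> ^^ d) v) = norm v" for v
    by (induction d) (simp_all add: norm_U)
  ultimately show ?thesis by (simp add: q(3))
qed

text \<open>The factor \<open>2 * degree P + 1\<close> disappears by the power trick, since
  \<open>norm (P(h) x)\<^sup>2 \<le> norm x * norm (P(h)\<^sup>2 x)\<close>.\<close>

lemma norm_poly_op_le:
  fixes h :: "'a::cstar_algebra"
  assumes h: "star h = h" "norm h < R" and M: "\<And>t. \<bar>t\<bar> \<le> R \<Longrightarrow> \<bar>poly P t\<bar> \<le> M"
  shows "norm (poly_op P ((*) h) x) \<le> M * norm x"
proof (rule ccontr)
  assume "\<not> ?thesis"
  then have gt: "M * norm x < norm (poly_op P ((*) h) x)" by simp
  have R: "R > 0" using h(2) norm_ge_zero[of h] by linarith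
  have M0: "M \<ge> 0" using M[of 0] R abs_ge_zero[of "poly P 0"] by linarith
  have x: "norm x > 0"
    using gt linear_0[OF linear_mult_left[of h]] poly_op_mult_right[of P h x 0]
    by (auto simp: poly_op_def)
  define N where "N = norm (poly_op P ((*) h) x) / norm x"
  have MN: "M < N" using gt x by (simp add: N_def field_simps)
  with M0 have N: "N > 0" by linarith
  have pow: "norm (poly_op Q ((*) h) x) ^ (2 ^ k) \<le> norm x ^ (2 ^ k - 1) * norm (poly_op (Q ^ (2 ^ k)) ((*) h) x)"
    for k Q
  proof (induction k arbitrary: Q)
    case (Suc k)
    have "norm (poly_op Q ((*) h) x) ^ 2 = norm (star x * poly_op (Q * Q) ((*) h) x)"
      by (simp add: cstar_identity[symmetric] poly_op_symmetric[OF h(1)] poly_op_mult[OF linear_mult_left])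
    also have "\<dots> \<le> norm x * norm (poly_op (Q * Q) ((*) h) x)"
      using norm_mult_ineq[of "star x"] by simp
    finally have "(norm (poly_op Q ((*) h) x) ^ 2) ^ (2 ^ k) \<le> (norm x * norm (poly_op (Q * Q) ((*) h) x)) ^ (2 ^ k)"
      by (intro power_mono) simp_all
    also have "\<dots> \<le> norm x ^ (2 ^ k) * (norm x ^ (2 ^ k - 1) * norm (poly_op ((Q * Q) ^ (2 ^ k)) ((*) h) x))"
      by (subst power_mult_distrib, intro mult_left_mono Suc.IH) simp
    also have "\<dots> = norm x ^ (2 ^ k + (2 ^ k - 1)) * norm (poly_op ((Q * Q) ^ (2 ^ k)) ((*) h) x)"
      by (simp only: power_add mult.assoc)
    also have "(2::nat) ^ k + (2 ^ k - 1) = 2 ^ Suc k - 1" by simp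
    also have "(Q * Q) ^ (2 ^ k) = Q ^ (2 ^ Suc k)"
      by (simp only: power2_eq_square[symmetric] power_mult[symmetric] power_Suc)
    finally show ?case by (simp only: power_mult[symmetric] power_Suc)
  qed simp
  have bound: "(N ^ (2 ^ k)) \<le> real (Suc (2 * (degree P * 2 ^ k))) * M ^ (2 ^ k)" for k
  proof -
    have "norm (poly_op (P ^ (2 ^ k)) ((*) h) x) \<le> real (Suc (2 * degree (P ^ (2 ^ k)))) * M ^ (2 ^ k) * norm x"
      by (intro norm_poly_op_le_degree[OF h])
        (use M in \<open>auto simp: poly_power power_abs intro!: power_mono\<close>)
    also have "\<dots> \<le> real (Suc (2 * (degree P * 2 ^ k))) * M ^ (2 ^ k) * norm x"
      using degree_power_le[of P "2 ^ k"] M0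
      by (intro mult_right_mono) (simp_all flip: of_nat_mult)
    finally have "norm (poly_op P ((*) h) x) ^ (2 ^ k)
       \<le> norm x ^ (2 ^ k - 1) * (real (Suc (2 * (degree P * 2 ^ k))) * M ^ (2 ^ k) * norm x)"
      by (intro order_trans[OF pow] mult_left_mono) simp_all
    also have "\<dots> = real (Suc (2 * (degree P * 2 ^ k))) * M ^ (2 ^ k) * norm x ^ (2 ^ k)"
      using power_minus_mult[of "2 ^ k" "norm x"] by (simp add: mult_ac)
    finally show ?thesis
      using x by (simp add: N_def power_divide field_simps)
  qed
  \<comment> \<open>By \<open>bound\<close>, (2 n degree P + 1) c^n is at least 1 for every n = 2^k;
    but it tends to 0 since c < 1.\<close>
  define c where "c = M / N"
  have c: "0 \<le> c" "c < 1" using M0 N MN by (auto simp: c_def)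
  have "(\<lambda>n. real (Suc (2 * (degree P * n))) * c ^ n) \<longlonglongrightarrow> 0"
  proof -
    have "(\<lambda>n. 2 * real (degree P) * (real n * c ^ n) + c ^ n) \<longlonglongrightarrow> 2 * real (degree P) * 0 + 0"
      using c by (intro tendsto_intros powser_times_n_limit_0 LIMSEQ_power_zero) auto
    then show ?thesis by (simp add: algebra_simps)
  qed
  then have "(\<lambda>k. real (Suc (2 * (degree P * 2 ^ k))) * c ^ (2 ^ k)) \<longlonglongrightarrow> 0"
    by (rule LIMSEQ_subseq_LIMSEQ[of _ _ "\<lambda>k. 2 ^ k", unfolded o_def]) (simp add: strict_mono_def)
  moreover have "1 \<le> real (Suc (2 * (degree P * 2 ^ k))) * c ^ (2 ^ k)" for k
    using bound[of k] N by (simp add: c_def power_divide field_simps)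
  ultimately show False
    by (metis (no_types, lifting) LIMSEQ_le_const not_one_le_zero)
qed

text \<open>Passes from operators to the element \<open>a\<close> = P(h) h of the algebra: left
  multiplication by \<open>a\<close> is the polynomial t P(t) in \<open>h\<close>, and
  \<open>norm (a * star a)\<close> is the square of \<open>norm a\<close>.\<close>

lemma norm_poly_op_self_le:
  fixes h :: "'a::cstar_algebra"
  assumes h: "star h = h" "norm h < R" and M: "\<And>t. \<bar>t\<bar> \<le> R \<Longrightarrow> \<bar>t * poly P t\<bar> \<le> M"
  shows "norm (poly_op P ((*) h) h) \<le> M"
proof -
  define a where "a = poly_op P ((*) h) h"
  have R: "R > 0" using h(2) norm_ge_zero[of h] by linarith
  have "a * x = poly_op (pCons 0 P) ((*) h) x" for x
    unfolding a_def poly_op_mult_right[symmetric]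
    by (simp add: poly_op_pCons[OF linear_mult_left]
        poly_op_commute[OF linear_mult_left linear_mult_left])
  then have *: "norm (a * x) \<le> M * norm x" for x
    using norm_poly_op_le[OF h, of "pCons 0 P" M x] M by simp
  show ?thesis
  proof (cases "a = 0")
    case True
    with M[of 0] R show ?thesis by (simp add: a_def)
  next
    case False
    have "norm a * norm a \<le> M * norm a"
      using *[of "star a"] cstar_identity[of "star a"] by (simp add: star_star power2_eq_square)
    with False show ?thesis by (simp add: a_def)
  qed
qed

section \<open>Functional calculus\<close>

lemma real_poly_approx:
  fixes f :: "real \<Rightarrow> real"
  assumes "continuous_on {-R..R} f" "0 < e"
  shows "\<exists>p. \<forall>t. \<bar>t\<bar> \<le> R \<longrightarrow> \<bar>poly p t - f t\<bar> < e"
proof -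
  obtain g where g: "real_polynomial_function g" "\<And>t. t \<in> {-R..R} \<Longrightarrow> \<bar>f t - g t\<bar> < e"
    by (rule Stone_Weierstrass_real_polynomial_function[OF compact_Icc assms]) blast
  from g(1) obtain a n where "g = (\<lambda>x. \<Sum>i\<le>n. a i * x ^ i)"
    using real_polynomial_function_imp_sum by blast
  then have "g t = poly (\<Sum>i\<le>n. monom (a i) i) t" for t
    by (simp add: poly_sum poly_monom)
  then show ?thesis
    using g(2) by (intro exI[of _ "\<Sum>i\<le>n. monom (a i) i"]) (auto simp: abs_le_iff abs_minus_commute)
qed

text \<open>Multiplied by t, the function \<open>\<delta> / max \<delta> \<bar>t\<bar>\<close>
  clamps t to [-\<delta>, \<delta>]; approximating this factor alone yields polynomials t p(t)
  without constant term. The intervals grow and the errors shrink with \<open>n\<close>, so one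
  sequence serves all elements of all algebras.\<close>

definition truncate_poly :: "real \<Rightarrow> nat \<Rightarrow> real poly" where
  "truncate_poly \<delta> n = (SOME p. \<forall>t. \<bar>t\<bar> \<le> real (Suc n) \<longrightarrow>
     \<bar>poly p t - \<delta> / max \<delta> \<bar>t\<bar>\<bar> < 1 / real (Suc n))"

text \<open>\<open>truncate \<delta> a\<close> is the functional calculus of \<open>t \<mapsto> max (-\<delta>) (min \<delta> t)\<close> at \<open>a\<close>.\<close>

definition truncate :: "real \<Rightarrow> 'a::cstar_algebra \<Rightarrow> 'a" where
  "truncate \<delta> a = lim (\<lambda>n. poly_op (truncate_poly \<delta> n) ((*) a) a)"

lemma truncate_poly_approx:
  assumes "\<delta> > 0" "\<bar>t\<bar> \<le> R" "R \<le> real (Suc n)"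
  shows "\<bar>t * poly (truncate_poly \<delta> n) t - t * (\<delta> / max \<delta> \<bar>t\<bar>)\<bar> \<le> R / real (Suc n)"
proof -
  have "\<exists>p. \<forall>t. \<bar>t\<bar> \<le> real (Suc n) \<longrightarrow> \<bar>poly p t - \<delta> / max \<delta> \<bar>t\<bar>\<bar> < 1 / real (Suc n)"
    using assms(1) by (intro real_poly_approx continuous_intros) auto
  then have "\<forall>t. \<bar>t\<bar> \<le> real (Suc n) \<longrightarrow>
      \<bar>poly (truncate_poly \<delta> n) t - \<delta> / max \<delta> \<bar>t\<bar>\<bar> < 1 / real (Suc n)"
    unfolding truncate_poly_def by (rule someI_ex)
  then have "\<bar>poly (truncate_poly \<delta> n) t - \<delta> / max \<delta> \<bar>t\<bar>\<bar> \<le> 1 / real (Suc n)"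
    using assms by (meson order_trans less_imp_le)
  then have "\<bar>t\<bar> * \<bar>poly (truncate_poly \<delta> n) t - \<delta> / max \<delta> \<bar>t\<bar>\<bar> \<le> R * (1 / real (Suc n))"
    using assms by (intro mult_mono) auto
  then show ?thesis by (simp add: abs_mult[symmetric] right_diff_distrib)
qed

lemma LIMSEQ_divide_Suc: "(\<lambda>n. c / real (Suc n)) \<longlonglongrightarrow> 0"
  using tendsto_mult_right_zero[OF LIMSEQ_inverse_real_of_nat, of c] by (simp add: divide_inverse)

lemma eventually_le_Suc: "\<forall>\<^sub>F n in sequentially. c \<le> real (Suc n)"
  by (meson eventually_sequentiallyI le_SucI of_nat_le_iff order_trans real_nat_ceiling_ge)

text \<open>On a bounded interval the functions t p_n(t) converge uniformly;
  \<open>norm_poly_op_self_le\<close> turns this into a Cauchy sequence in the algebra.\<close>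

lemma truncate_LIMSEQ:
  fixes a :: "'a::cstar_algebra"
  assumes "star a = a" "\<delta> > 0"
  shows "(\<lambda>n. poly_op (truncate_poly \<delta> n) ((*) a) a) \<longlonglongrightarrow> truncate \<delta> a"
proof -
  define R where "R = norm a + 1"
  have R: "norm a < R" "R > 0" by (simp_all add: R_def add_nonneg_pos)
  have "Cauchy (\<lambda>n. poly_op (truncate_poly \<delta> n) ((*) a) a)"
  proof (rule CauchyI)
    fix e :: real assume "0 < e"
    then have "\<forall>\<^sub>F n in sequentially. 2 * R / real (Suc n) < e"
      by (intro order_tendstoD(2)[OF LIMSEQ_divide_Suc])
    then have "\<forall>\<^sub>F n in sequentially. 2 * R / real (Suc n) < e \<and> R \<le> real (Suc n)"
      by (intro eventually_conj eventually_le_Suc)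
    then obtain N where N: "2 * R / real (Suc N) < e" "R \<le> real (Suc N)"
      by (auto simp: eventually_sequentially)
    show "\<exists>M. \<forall>m\<ge>M. \<forall>n\<ge>M.
        norm (poly_op (truncate_poly \<delta> m) ((*) a) a - poly_op (truncate_poly \<delta> n) ((*) a) a) < e"
    proof (intro exI allI impI)
      fix m n assume mn: "N \<le> m" "N \<le> n"
      have "norm (poly_op (truncate_poly \<delta> m - truncate_poly \<delta> n) ((*) a) a) \<le> 2 * R / real (Suc N)"
      proof (rule norm_poly_op_self_le[OF assms(1) R(1)])
        fix t assume t: "\<bar>t\<bar> \<le> R"
        have k: "\<bar>t * poly (truncate_poly \<delta> k) t - t * (\<delta> / max \<delta> \<bar>t\<bar>)\<bar> \<le> R / real (Suc N)" if "N \<le> k" for k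
        proof -
          have "R / real (Suc k) \<le> R / real (Suc N)"
            using R that by (intro divide_left_mono) auto
          then show ?thesis
            using truncate_poly_approx[OF assms(2) t, of k] N(2) that by simp
        qed
        show "\<bar>t * poly (truncate_poly \<delta> m - truncate_poly \<delta> n) t\<bar> \<le> 2 * R / real (Suc N)"
        proof -
          have tri: "\<bar>u - w\<bar> \<le> c \<Longrightarrow> \<bar>v - w\<bar> \<le> c \<Longrightarrow> \<bar>u - v\<bar> \<le> c + c" for u v w c :: real
            by linarith
          show ?thesis
            using tri[OF k[OF mn(1)] k[OF mn(2)]] by (simp add: right_diff_distrib)
        qed
      qed
      then show "norm (poly_op (truncate_poly \<delta> m) ((*) a) a - poly_op (truncate_poly \<delta> n) ((*) a) a) < e"
        using N(1) by (simp add: poly_op_diff)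
    qed
  qed
  then show ?thesis
    unfolding truncate_def using Cauchy_convergent_iff convergent_LIMSEQ_iff by blast
qed

lemma abs_truncate_real_le:
  fixes t :: real
  assumes "\<delta> > 0"
  shows "\<bar>t * (\<delta> / max \<delta> \<bar>t\<bar>)\<bar> \<le> \<delta>"
  using assms by (auto simp: abs_mult max_def field_simps)

lemma norm_truncate_le:
  fixes a :: "'a::cstar_algebra"
  assumes "star a = a" "\<delta> > 0"
  shows "norm (truncate \<delta> a) \<le> \<delta>"
proof -
  define R where "R = norm a + 1"
  have R: "norm a < R" by (simp add: R_def)
  have "\<forall>\<^sub>F n in sequentially. norm (poly_op (truncate_poly \<delta> n) ((*) a) a) \<le> \<delta> + R / real (Suc n)"
    using eventually_le_Suc[of R]
  proof eventually_elim
    case (elim n)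
    show ?case
    proof (rule norm_poly_op_self_le[OF assms(1) R])
      fix t assume t: "\<bar>t\<bar> \<le> R"
      show "\<bar>t * poly (truncate_poly \<delta> n) t\<bar> \<le> \<delta> + R / real (Suc n)"
      proof -
        have tri: "\<bar>u - w\<bar> \<le> c \<Longrightarrow> \<bar>w\<bar> \<le> d \<Longrightarrow> \<bar>u\<bar> \<le> d + c" for u w c d :: real
          by linarith
        show ?thesis
          by (rule tri[OF truncate_poly_approx[OF assms(2) t elim] abs_truncate_real_le[OF assms(2)]])
      qed
    qed
  qed
  then show ?thesis
    using tendsto_add[OF tendsto_const[of \<delta>] LIMSEQ_divide_Suc[of R]]
    by (intro tendsto_le[OF _ _ tendsto_norm[OF truncate_LIMSEQ[OF assms]]]) auto
qed

text \<open>The clamp is the identity on [-\<delta>, \<delta>], so t p_n(t) - t tends to 0 uniformly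
  there.\<close>

lemma truncate_eq_self:
  fixes a :: "'a::cstar_algebra"
  assumes "star a = a" "norm a < \<delta>"
  shows "truncate \<delta> a = a"
proof -
  have \<delta>: "\<delta> > 0" using assms(2) norm_ge_zero[of a] by linarith
  have "\<forall>\<^sub>F n in sequentially. norm (poly_op (truncate_poly \<delta> n) ((*) a) a - a) \<le> \<delta> / real (Suc n)"
    using eventually_le_Suc[of \<delta>]
  proof eventually_elim
    case (elim n)
    have "norm (poly_op (truncate_poly \<delta> n - 1) ((*) a) a) \<le> \<delta> / real (Suc n)"
    proof (rule norm_poly_op_self_le[OF assms])
      fix t assume "\<bar>t\<bar> \<le> \<delta>"
      then show "\<bar>t * poly (truncate_poly \<delta> n - 1) t\<bar> \<le> \<delta> / real (Suc n)"
        using truncate_poly_approx[OF \<delta> _ elim, of t] \<delta> by (simp add: max_def right_diff_distrib)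
    qed
    then show ?case by (simp add: poly_op_diff)
  qed
  then have "(\<lambda>n. poly_op (truncate_poly \<delta> n) ((*) a) a - a) \<longlonglongrightarrow> 0"
    by (rule Lim_null_comparison) (rule LIMSEQ_divide_Suc)
  then have "(\<lambda>n. poly_op (truncate_poly \<delta> n) ((*) a) a) \<longlonglongrightarrow> a"
    by (simp add: LIM_zero_iff)
  with truncate_LIMSEQ[OF assms(1) \<delta>] show ?thesis by (rule LIMSEQ_unique)
qed

lemma poly_op_mem:
  assumes "linear T" "0 \<in> N" "\<And>x y. x \<in> N \<Longrightarrow> y \<in> N \<Longrightarrow> x + y \<in> N"
    "\<And>r x. x \<in> N \<Longrightarrow> r *\<^sub>R x \<in> N" "\<And>x. x \<in> N \<Longrightarrow> T x \<in> N" "x \<in> N"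
  shows "poly_op p T x \<in> N"
  by (induction p) (use assms in \<open>simp_all add: poly_op_pCons\<close>)

lemma poly_op_map_prod:
  assumes "linear S" "linear T"
  shows "poly_op p (map_prod S T) (x, y) = (poly_op p S x, poly_op p T y)"
proof -
  have "linear (map_prod S T)"
    by (rule linearI)
      (auto simp: linear_add[OF assms(1)] linear_add[OF assms(2)]
        linear_scale[OF assms(1)] linear_scale[OF assms(2)])
  then show ?thesis
    by (induction p) (simp_all add: poly_op_pCons assms zero_prod_def)
qed

lemma poly_op_self_adjoint:
  fixes h :: "'a::cstar_algebra"
  assumes "star h = h"
  shows "star (poly_op p ((*) h) h) = poly_op p ((*) h) h"
proof (induction p)
  case (pCons a p)
  have "poly_op p ((*) h) h * h = h * poly_op p ((*) h) h"
    by (simp add: poly_op_mult_right[symmetric] poly_op_commute[OF linear_mult_left linear_mult_left])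
  with pCons show ?case
    by (simp add: poly_op_pCons[OF linear_mult_left] star_add star_scaleR star_mult assms)
qed simp

section \<open>Approximate units and their consequences for closed ideals\<close>

lemma approximate_unit_poly:
  fixes R \<epsilon> :: real
  assumes "R > 0" "\<epsilon> > 0"
  shows "\<exists>q. \<forall>t. \<bar>t\<bar> \<le> R \<longrightarrow> \<bar>t * (poly (pCons 1 q) t * poly (pCons 1 q) t)\<bar> \<le> \<epsilon>"
proof -
  define \<theta> where "\<theta> = min (\<epsilon> / R) 1"
  have \<theta>: "0 < \<theta>" "\<theta> \<le> 1" "\<theta> * R \<le> \<epsilon>" using assms by (auto simp: \<theta>_def min_def field_simps)
  have "0 < \<theta> ^ 2" "\<theta> ^ 2 \<le> 1" using \<theta> by (auto intro: power_le_one)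
  then obtain n where n: "(1 - \<theta>\<^sup>2) ^ n < \<theta>"
    using real_arch_pow_inv[of \<theta> "1 - \<theta>\<^sup>2"] \<theta> by auto
  \<comment> \<open>This is (1 - (t/R)^2)^n, with constant term 1 and values in [0, 1] on [-R, R].
    The product of t with its square is small for \<bar>t\<bar> \<le> \<theta> R because of the
    factor t, and elsewhere because the power is below \<theta>.\<close>
  define r where "r = [:1, 0, - 1 / R\<^sup>2:] ^ n"
  have pr: "poly r t = (1 - (t / R)\<^sup>2) ^ n" for t
    by (simp add: r_def poly_power power2_eq_square)
  obtain c q where r: "r = pCons c q" by (cases r)
  have "c = 1" using pr[of 0] by (simp add: r)
  have "\<bar>t * (poly r t * poly r t)\<bar> \<le> \<epsilon>" if t: "\<bar>t\<bar> \<le> R" for t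
  proof -
    define v where "v = (t / R)\<^sup>2"
    have "\<bar>t / R\<bar> \<le> 1" using t assms by simp
    then have v: "0 \<le> v" "v \<le> 1" by (simp_all add: v_def abs_square_le_1)
    then have p: "0 \<le> poly r t" "poly r t \<le> 1"
      unfolding pr v_def[symmetric] by (auto intro: power_le_one)
    then have pp: "poly r t * poly r t \<le> poly r t" by (simp add: mult_left_le)
    have "\<bar>t\<bar> * (poly r t * poly r t) \<le> \<theta> * R"
    proof (cases "\<bar>t\<bar> \<le> \<theta> * R")
      case True
      have "poly r t * poly r t \<le> 1" using pp p by linarith
      with True p show ?thesis
        using mult_mono[of "\<bar>t\<bar>" "\<theta> * R" "poly r t * poly r t" 1] \<theta> assms by simp
    next
      case False
      then have "\<theta> \<le> \<bar>t / R\<bar>" using assms by (simp add: field_simps)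
      then have "\<theta>\<^sup>2 \<le> v" using \<theta> by (metis power2_abs power_mono less_imp_le v_def)
      then have "poly r t \<le> (1 - \<theta>\<^sup>2) ^ n"
        unfolding pr v_def[symmetric] using v by (intro power_mono) auto
      then have "poly r t * poly r t \<le> \<theta>" using n pp by linarith
      with t p show ?thesis
        using mult_mono[of "\<bar>t\<bar>" R "poly r t * poly r t" \<theta>] assms by (simp add: mult.commute)
    qed
    with p \<theta> show ?thesis by (simp add: abs_mult)
  qed
  then show ?thesis using r \<open>c = 1\<close> by blast
qed

text \<open>For h = \<open>star x * x\<close>, r = 1 + t q and y = r(h) \<open>star x\<close>, the
  product \<open>y * star y\<close> equals h r(h)^2, whose norm the hypothesis bounds by
  \<open>\<epsilon>\<^sup>2\<close>.\<close>

lemma norm_approximate_unit_le: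
  fixes x :: "'a::cstar_algebra"
  assumes "norm x ^ 2 < R" "\<forall>t. \<bar>t\<bar> \<le> R \<longrightarrow> \<bar>t * (poly (pCons 1 q) t * poly (pCons 1 q) t)\<bar> \<le> \<epsilon>\<^sup>2" "\<epsilon> \<ge> 0"
  shows "norm (star x + star x * x * poly_op q ((*) (star x * x)) (star x)) \<le> \<epsilon>"
proof -
  define h where "h = star x * x"
  have h: "star h = h" "norm h < R" using assms by (simp_all add: h_def star_mult star_star cstar_identity)
  define r where "r = pCons 1 q"
  define y where "y = poly_op r ((*) h) (star x)"
  have "star x * star y = star (poly_op r ((*) h) h)"
    by (simp add: y_def star_mult[symmetric] poly_op_mult_right[symmetric] h_def)
  then have "star x * star y = poly_op r ((*) h) h"
    by (simp add: poly_op_self_adjoint[OF h(1)])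
  then have "y * star y = poly_op (r * r) ((*) h) h"
    by (simp add: y_def poly_op_mult[OF linear_mult_left] poly_op_mult_right[symmetric])
  moreover have "norm (poly_op (r * r) ((*) h) h) \<le> \<epsilon>\<^sup>2"
    using assms(2) by (intro norm_poly_op_self_le[OF h]) (simp only: r_def poly_mult)
  ultimately have "norm y ^ 2 \<le> \<epsilon>\<^sup>2"
    using cstar_identity[of "star y"] by (simp add: star_star)
  then have "norm y \<le> \<epsilon>" using assms(3) by (simp add: power2_le_iff_abs_le)
  then show ?thesis by (simp add: y_def r_def poly_op_pCons[OF linear_mult_left] h_def)
qed

lemma closed_idealD:
  assumes "closed_ideal I"
  shows "0 \<in> I" "x \<in> I \<Longrightarrow> y \<in> I \<Longrightarrow> x + y \<in> I" "x \<in> I \<Longrightarrow> scaleC c x \<in> I"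
    "x \<in> I \<Longrightarrow> r *\<^sub>R x \<in> I" "x \<in> I \<Longrightarrow> a * x \<in> I" "x \<in> I \<Longrightarrow> x * a \<in> I" "closed I"
    "x \<in> I \<Longrightarrow> - x \<in> I" "x \<in> I \<Longrightarrow> y \<in> I \<Longrightarrow> x - y \<in> I"
proof -
  show *: "0 \<in> I" "x \<in> I \<Longrightarrow> y \<in> I \<Longrightarrow> x + y \<in> I" "x \<in> I \<Longrightarrow> scaleC c x \<in> I"
    "x \<in> I \<Longrightarrow> a * x \<in> I" "x \<in> I \<Longrightarrow> x * a \<in> I" "closed I" for x y c a
    using assms by (auto simp: closed_ideal_def)
  show "x \<in> I \<Longrightarrow> r *\<^sub>R x \<in> I" using *(3)[of x "of_real r"] by (simp add: scaleC_of_real)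
  show m: "x \<in> I \<Longrightarrow> - x \<in> I" for x using *(3)[of x "-1"] by (simp add: scaleC_minus_one)
  show "x \<in> I \<Longrightarrow> y \<in> I \<Longrightarrow> x - y \<in> I" using *(2)[of x "- y"] m[of y] by simp
qed

text \<open>The polynomial \<open>pCons 1 q\<close> has constant term 1, so the bound says that
  \<open>star x\<close> is nearly \<open>star x * x\<close> times an element of the algebra.\<close>

lemma approximate_unit:
  fixes x :: "'a::cstar_algebra"
  assumes "\<epsilon> > 0"
  shows "\<exists>q. norm (star x + star x * x * poly_op q ((*) (star x * x)) (star x)) \<le> \<epsilon>"
proof -
  have "norm x ^ 2 + 1 > 0" by (simp add: add_nonneg_pos)
  then obtain q where "\<forall>t. \<bar>t\<bar> \<le> norm x ^ 2 + 1 \<longrightarrow>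
      \<bar>t * (poly (pCons 1 q) t * poly (pCons 1 q) t)\<bar> \<le> \<epsilon>\<^sup>2"
    using approximate_unit_poly[of "norm x ^ 2 + 1" "\<epsilon>\<^sup>2"] assms by auto
  then show ?thesis
    using assms norm_approximate_unit_le[of x "norm x ^ 2 + 1" q \<epsilon>] by auto
qed

text \<open>The approximants of \<open>star x\<close> have a factor \<open>x\<close>, hence lie in
  the closed set \<open>I\<close>.\<close>

lemma closed_ideal_star:
  assumes I: "closed_ideal I" and x: "x \<in> I"
  shows "star x \<in> I"
proof -
  have "\<exists>y\<in>I. dist y (star x) < e" if e: "e > 0" for e
  proof -
    obtain q where q: "norm (star x + star x * x * poly_op q ((*) (star x * x)) (star x)) \<le> e/2"
      using approximate_unit[of "e/2" x] e by auto
    have "- (star x * x * poly_op q ((*) (star x * x)) (star x)) \<in> I"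
      by (intro closed_idealD[OF I] x)
    moreover have "dist (- (star x * x * poly_op q ((*) (star x * x)) (star x))) (star x) < e"
      using q e by (simp add: dist_norm norm_minus_commute)
    ultimately show ?thesis by blast
  qed
  then show ?thesis using closed_approachable[OF closed_idealD(7)[OF I]] by blast
qed

text \<open>Exchanging \<open>x\<close> and \<open>star x\<close> in \<open>approximate_unit\<close>
  approximates \<open>x\<close> by \<open>x * star x * w\<close> with all three factors in
  \<open>I\<close>. The set \<open>W\<close> is only assumed to be closed.\<close>

lemma closed_ideal_subset_if_triple_products:
  assumes I: "closed_ideal I" and W: "closed W"
    and uvw: "\<And>u v w. u \<in> I \<Longrightarrow> v \<in> I \<Longrightarrow> w \<in> I \<Longrightarrow> u * v * w \<in> W"
  shows "I \<subseteq> W"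
proof
  fix x assume x: "x \<in> I"
  have "\<exists>y\<in>W. dist y x < e" if e: "e > 0" for e
  proof -
    obtain q where q: "norm (x + x * star x * poly_op q ((*) (x * star x)) x) \<le> e/2"
      using approximate_unit[of "e/2" "star x"] e by (auto simp: star_star)
    have "poly_op q ((*) (x * star x)) x \<in> I"
      by (rule poly_op_mem) (auto intro!: linear_mult_left x closed_idealD[OF I])
    then have "x * star x * (- poly_op q ((*) (x * star x)) x) \<in> W"
      by (intro uvw x closed_ideal_star[OF I] closed_idealD[OF I])
    moreover have "dist (x * star x * (- poly_op q ((*) (x * star x)) x)) x < e"
      using q e by (simp add: dist_norm norm_minus_commute)
    ultimately show ?thesis by blast
  qed
  then show "x \<in> W" using closed_approachable[OF W] by blast
qed

lemma poly_op_diff_mem: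
  assumes I: "closed_ideal I" and "a - b \<in> I" "x - y \<in> I"
  shows "poly_op p ((*) a) x - poly_op p ((*) b) y \<in> I"
proof (induction p)
  case (pCons c p)
  have "c *\<^sub>R (x - y) + a * (poly_op p ((*) a) x - poly_op p ((*) b) y)
      + (a - b) * poly_op p ((*) b) y \<in> I"
    by (intro closed_idealD[OF I] assms pCons.IH)
  then show ?case by (simp add: poly_op_pCons[OF linear_mult_left] algebra_simps)
qed (simp add: closed_idealD[OF I])

text \<open>Polynomials respect congruence modulo an ideal, and \<open>I\<close> is closed under the
  limits defining \<open>truncate\<close>.\<close>

lemma truncate_diff_mem:
  assumes I: "closed_ideal I" and "a - b \<in> I" "star a = a" "star b = b" "\<delta> > 0"
  shows "truncate \<delta> a - truncate \<delta> b \<in> I"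
  by (rule closed_sequentially[OF closed_idealD(7)[OF I] _ tendsto_diff[OF truncate_LIMSEQ truncate_LIMSEQ]])
    (use assms in \<open>auto intro: poly_op_diff_mem\<close>)

section \<open>Closed *-subalgebras of a product\<close>

text \<open>Written componentwise: the norm of the product type is Euclidean and thus not a C*-norm,
  but it induces the right topology.\<close>

definition closed_star_subalgebra :: "('a::cstar_algebra \<times> 'b::cstar_algebra) set \<Rightarrow> bool" where
  "closed_star_subalgebra M \<longleftrightarrow> closed M \<and> (0, 0) \<in> M \<and>
     (\<forall>(x1, x2)\<in>M. \<forall>(y1, y2)\<in>M. (x1 + y1, x2 + y2) \<in> M \<and> (x1 * y1, x2 * y2) \<in> M) \<and>
     (\<forall>(x1, x2)\<in>M. (star x1, star x2) \<in> M \<and> (\<forall>c. (scaleC c x1, scaleC c x2) \<in> M))"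

context
  fixes M :: "('a::cstar_algebra \<times> 'b::cstar_algebra) set"
  assumes M: "closed_star_subalgebra M"
begin

lemma closed_star_subalgebraD:
  "closed M" "(0, 0) \<in> M" "(a, b) \<in> M \<Longrightarrow> (a', b') \<in> M \<Longrightarrow> (a + a', b + b') \<in> M"
  "(a, b) \<in> M \<Longrightarrow> (a', b') \<in> M \<Longrightarrow> (a * a', b * b') \<in> M" "(a, b) \<in> M \<Longrightarrow> (star a, star b) \<in> M"
  "(a, b) \<in> M \<Longrightarrow> (scaleC c a, scaleC c b) \<in> M" "(a, b) \<in> M \<Longrightarrow> (r *\<^sub>R a, r *\<^sub>R b) \<in> M"
  "(a, b) \<in> M \<Longrightarrow> (a', b') \<in> M \<Longrightarrow> (a - a', b - b') \<in> M"
proof -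
  show *: "closed M" "(0, 0) \<in> M" "(a, b) \<in> M \<Longrightarrow> (a', b') \<in> M \<Longrightarrow> (a + a', b + b') \<in> M"
    "(a, b) \<in> M \<Longrightarrow> (a', b') \<in> M \<Longrightarrow> (a * a', b * b') \<in> M" "(a, b) \<in> M \<Longrightarrow> (star a, star b) \<in> M"
    "(a, b) \<in> M \<Longrightarrow> (scaleC c a, scaleC c b) \<in> M" for a b a' b' c
    using M unfolding closed_star_subalgebra_def by blast+
  show "(a, b) \<in> M \<Longrightarrow> (r *\<^sub>R a, r *\<^sub>R b) \<in> M"
    using *(6)[of a b "of_real r"] by (simp add: scaleC_of_real)
  show "(a, b) \<in> M \<Longrightarrow> (a', b') \<in> M \<Longrightarrow> (a - a', b - b') \<in> M"
    using *(6)[of a' b' "-1"] *(3)[of a b "- a'" "- b'"] by (simp add: scaleC_minus_one)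
qed

text \<open>Both coordinates use the same polynomials, so the pair is a limit of polynomials in the
  element \<open>(a, b)\<close> of \<open>M\<close>.\<close>

lemma truncate_mem:
  assumes ab: "(a, b) \<in> M" and sa: "star a = a" "star b = b" and "\<delta> > 0"
  shows "(truncate \<delta> a, truncate \<delta> b) \<in> M"
proof (rule closed_sequentially[OF closed_star_subalgebraD(1) _ tendsto_Pair[OF truncate_LIMSEQ truncate_LIMSEQ]])
  fix n
  have "poly_op (truncate_poly \<delta> n) (map_prod ((*) a) ((*) b)) (a, b) \<in> M"
  proof (rule poly_op_mem)
    show "linear (map_prod ((*) a) ((*) b))"
      by (rule linearI) (auto simp: distrib_left)
  qed (use ab closed_star_subalgebraD in \<open>auto simp: zero_prod_def\<close>)
  then show "(poly_op (truncate_poly \<delta> n) ((*) a) a, poly_op (truncate_poly \<delta> n) ((*) b) b) \<in> M"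
    by (simp add: poly_op_map_prod linear_mult_left)
qed (use assms in auto)

lemma self_adjoint_parts:
  assumes "(a, b) \<in> M"
  obtains a1 b1 a2 b2 where "(a1, b1) \<in> M" "(a2, b2) \<in> M"
    "star a1 = a1" "star b1 = b1" "star a2 = a2" "star b2 = b2"
    "a = a1 + scaleC \<i> a2" "b = b1 + scaleC \<i> b2" "norm b1 \<le> norm b" "norm b2 \<le> norm b"
proof -
  have i: "scaleC \<i> (scaleC (- \<i>/2) x) = (1/2) *\<^sub>R x" for x :: "'c::cstar_algebra"
    using scaleC_of_real[of "1/2" x] by (simp add: scaleC_scaleC)
  have half: "norm ((1/2) *\<^sub>R (x + star x)) \<le> norm x" "norm (scaleC (- \<i>/2) (x - star x)) \<le> norm x"
    for x :: "'c::cstar_algebra"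
    using norm_triangle_ineq[of x "star x"] norm_triangle_ineq4[of x "star x"]
    by (simp_all add: norm_scaleC norm_divide)
  have dec: "x = (1/2) *\<^sub>R (x + star x) + scaleC \<i> (scaleC (- \<i>/2) (x - star x))" for x :: "'c::cstar_algebra"
    unfolding i scaleR_right_distrib[symmetric] by (simp flip: scaleR_2)
  have sa: "star ((1/2) *\<^sub>R (x + star x)) = (1/2) *\<^sub>R (x + star x)"
    "star (scaleC (- \<i>/2) (x - star x)) = scaleC (- \<i>/2) (x - star x)" for x :: "'c::cstar_algebra"
    by (simp_all add: star_scaleR star_scaleC star_add star_star add.commute[of "star x"] star_diff
        scaleC_diff_right scaleC_minus_left)
  show ?thesis
  proof (rule that)
    show "((1/2) *\<^sub>R (a + star a), (1/2) *\<^sub>R (b + star b)) \<in> M"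
      "(scaleC (- \<i>/2) (a - star a), scaleC (- \<i>/2) (b - star b)) \<in> M"
      by (intro closed_star_subalgebraD assms)+
    show "norm ((1/2) *\<^sub>R (b + star b)) \<le> norm b" "norm (scaleC (- \<i>/2) (b - star b)) \<le> norm b"
      by (rule half)+
  qed (rule sa dec)+
qed

text \<open>Truncating the self-adjoint parts of \<open>(a, b)\<close> above \<open>norm b\<close> does not change \<open>b\<close>.\<close>

lemma bounded_lift:
  assumes "(a, b) \<in> M"
  obtains a' where "(a', b) \<in> M" "norm a' \<le> 4 * norm b"
proof (cases "b = 0")
  case True
  then show ?thesis using that[of 0] closed_star_subalgebraD by simp
next
  case False
  obtain a1 b1 a2 b2 where *: "(a1, b1) \<in> M" "(a2, b2) \<in> M"
    "star a1 = a1" "star b1 = b1" "star a2 = a2" "star b2 = b2"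
    "a = a1 + scaleC \<i> a2" "b = b1 + scaleC \<i> b2" "norm b1 \<le> norm b" "norm b2 \<le> norm b"
    by (rule self_adjoint_parts[OF assms])
  \<comment> \<open>\<open>truncate_eq_self\<close> needs the parts of \<open>b\<close> strictly
    below \<open>\<delta>\<close>; the two truncated parts of \<open>a\<close> then add up to norm
    at most \<open>2 * \<delta>\<close>, which is \<open>4 * norm b\<close>.\<close>
  define \<delta> where "\<delta> = 2 * norm b"
  have \<delta>: "\<delta> > 0" "norm b1 < \<delta>" "norm b2 < \<delta>"
    using False *(9,10) zero_less_norm_iff[of b] unfolding \<delta>_def by linarith+
  have "(truncate \<delta> a1 + scaleC \<i> (truncate \<delta> a2), truncate \<delta> b1 + scaleC \<i> (truncate \<delta> b2)) \<in> M"
    by (intro closed_star_subalgebraD truncate_mem * \<delta>)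
  moreover have "truncate \<delta> b1 + scaleC \<i> (truncate \<delta> b2) = b"
    using * \<delta> by (simp add: truncate_eq_self)
  moreover have "norm (truncate \<delta> a1 + scaleC \<i> (truncate \<delta> a2)) \<le> \<delta> + \<delta>"
    using norm_truncate_le[OF *(3) \<delta>(1)] norm_truncate_le[OF *(5) \<delta>(1)]
    by (intro order_trans[OF norm_triangle_ineq] add_mono) (simp_all add: norm_scaleC)
  ultimately show ?thesis using that by (simp add: \<delta>_def)
qed

text \<open>An open mapping argument: a limit \<open>c\<close> of second coordinates is approached
  geometrically, each increment is lifted by \<open>bounded_lift\<close>, and the lifts sum to a
  first coordinate for \<open>c\<close>.\<close>

lemma closed_snd_image: "closed (snd ` M)"
proof -
  have fib: "\<exists>a. (a, b) \<in> M" if "b \<in> snd ` M" for b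
    using that by auto
  have "c \<in> snd ` M" if c: "c \<in> closure (snd ` M)" for c
  proof -
    have "\<exists>y\<in>snd ` M. dist y c < (1/2) ^ n" for n
      using c by (simp add: closure_approachable)
    then obtain s where s: "\<And>n. s n \<in> snd ` M" "\<And>n. dist (s n) c < (1/2) ^ n" by metis
    have "\<exists>a. (a, s (Suc n) - s n) \<in> M \<and> norm a \<le> 8 * (1/2) ^ n" for n
    proof -
      obtain a1 a2 where "(a1, s (Suc n)) \<in> M" "(a2, s n) \<in> M"
        using fib[OF s(1)[of n]] fib[OF s(1)[of "Suc n"]] by blast
      then have "(a1 - a2, s (Suc n) - s n) \<in> M" by (intro closed_star_subalgebraD)
      then obtain a where a: "(a, s (Suc n) - s n) \<in> M" "norm a \<le> 4 * norm (s (Suc n) - s n)"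
        by (rule bounded_lift)
      have "norm (s (Suc n) - s n) \<le> dist (s (Suc n)) c + dist (s n) c"
        using dist_triangle2[of "s (Suc n)" "s n" c] by (simp add: dist_norm)
      also have "\<dots> \<le> (1/2) ^ n + (1/2) ^ n"
      proof (intro add_mono less_imp_le[OF s(2)])
        have "(1/2::real) ^ Suc n \<le> (1/2) ^ n" by simp
        with s(2)[of "Suc n"] show "dist (s (Suc n)) c \<le> (1/2) ^ n" by linarith
      qed
      finally have "norm a \<le> 8 * (1/2) ^ n" using a(2) by linarith
      with a(1) show ?thesis by blast
    qed
    then obtain a where a: "\<And>n. (a n, s (Suc n) - s n) \<in> M" "\<And>n. norm (a n) \<le> 8 * (1/2) ^ n"
      by metis
    have "summable a"
      by (rule summable_comparison_test[of _ "\<lambda>n. 8 * (1/2) ^ n"])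
        (use a(2) in \<open>auto intro!: summable_mult summable_geometric\<close>)
    then have lim: "(\<lambda>n. \<Sum>i<n. a i) \<longlonglongrightarrow> suminf a" by (rule summable_LIMSEQ)
    obtain a0 where a0: "(a0, s 0) \<in> M" using fib[OF s(1)[of 0]] by blast
    have mem: "(a0 + (\<Sum>i<n. a i), s n) \<in> M" for n
    proof (induction n)
      case (Suc n)
      from closed_star_subalgebraD(3)[OF this a(1)[of n]] show ?case by (simp add: add.assoc)
    qed (simp add: a0)
    have "(\<lambda>n. (1/2::real) ^ n) \<longlonglongrightarrow> 0" by (rule LIMSEQ_power_zero) simp
    then have "(\<lambda>n. dist (s n) c) \<longlonglongrightarrow> 0"
      by (rule Lim_null_comparison[rotated]) (simp add: less_imp_le s(2))
    then have "s \<longlonglongrightarrow> c" by (rule tendsto_dist_iff[THEN iffD2])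
    then have "(\<lambda>n. (a0 + (\<Sum>i<n. a i), s n)) \<longlonglongrightarrow> (a0 + suminf a, c)"
      by (intro tendsto_Pair tendsto_add tendsto_const lim)
    then have "(a0 + suminf a, c) \<in> M"
      by (rule closed_sequentially[OF closed_star_subalgebraD(1) mem])
    then show ?thesis by force
  qed
  then show ?thesis using closure_subset_eq by blast
qed

end

section \<open>The lattice of closed ideals\<close>

lemma closed_ideal_Inter:
  assumes "\<And>I. I \<in> F \<Longrightarrow> closed_ideal I"
  shows "closed_ideal (\<Inter>F)"
  using assms unfolding closed_ideal_def by (auto intro!: closed_Inter)

lemma closed_ideal_Ideal: "closed_ideal (Ideal S)"
  unfolding Ideal_def by (rule closed_ideal_Inter) (simp add: Lat_def)

lemma subset_Ideal: "S \<subseteq> Ideal S"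
  by (auto simp: Ideal_def)

lemma Ideal_least: "closed_ideal I \<Longrightarrow> S \<subseteq> I \<Longrightarrow> Ideal S \<subseteq> I"
  by (auto simp: Ideal_def Lat_def)

lemma Ideal_mono: "S \<subseteq> T \<Longrightarrow> Ideal S \<subseteq> Ideal T"
  by (meson Ideal_least closed_ideal_Ideal subset_Ideal order_trans)

lemma Ideal_eq_self: "closed_ideal I \<Longrightarrow> Ideal I = I"
  by (simp add: Ideal_least subset_Ideal subset_antisym)

lemma bounded_linear_scaleC: "bounded_linear (scaleC c :: 'a::cstar_algebra \<Rightarrow> 'a)"
  by (rule bounded_linear_intro[where K="cmod c"])
    (simp_all add: scaleC_add_right scaleC_scaleR norm_scaleC)

lemma closed_ideal_vimage:
  assumes f: "star_hom f" and I: "closed_ideal I"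
  shows "closed_ideal (f -` I)"
proof -
  have "closed (f -` I)"
    by (rule closed_vimage[OF closed_idealD(7)[OF I] linear_continuous_on[OF star_hom_bounded_linear[OF f]]])
  then show ?thesis
    unfolding closed_ideal_def by (simp add: star_homD[OF f] closed_idealD[OF I])
qed

text \<open>The image is the second projection of the graph, a closed *-subalgebra of the product.\<close>

lemma closed_ideal_image:
  assumes f: "star_hom f" and "surj f" and I: "closed_ideal I"
  shows "closed_ideal (f ` I)"
proof -
  define M where "M = {(a, c). a \<in> I \<and> f a = c}"
  have cf: "continuous_on UNIV f" by (rule linear_continuous_on[OF star_hom_bounded_linear[OF f]])
  have "M = (I \<times> UNIV) \<inter> {p. f (fst p) = snd p}" by (auto simp: M_def)
  moreover have "closed {p. f (fst p) = snd p}"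
    by (intro closed_Collect_eq continuous_on_compose2[OF cf] continuous_intros) auto
  ultimately have "closed M"
    using closed_idealD(7)[OF I] by (simp add: closed_Int closed_Times)
  then have "closed_star_subalgebra M"
    unfolding closed_star_subalgebra_def M_def
    by (auto simp: star_homD[OF f] intro: closed_idealD[OF I] closed_ideal_star[OF I])
  then have "closed (snd ` M)" by (rule closed_snd_image)
  also have "snd ` M = f ` I" by (force simp: M_def)
  finally have "closed (f ` I)" .
  moreover have "c * f x \<in> f ` I \<and> f x * c \<in> f ` I" if "x \<in> I" for c x
  proof -
    obtain a where "c = f a" using \<open>surj f\<close> by auto
    then show ?thesis
      using that closed_idealD(5,6)[OF I] by (auto simp flip: star_homD(3)[OF f])
  qed
  moreover have "0 \<in> f ` I"
    by (metis closed_idealD(1)[OF I] image_eqI star_homD(5)[OF f])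
  ultimately show ?thesis
    unfolding closed_ideal_def
    by (intro conjI ballI allI; clarsimp simp flip: star_homD(1,2)[OF f] simp: closed_idealD[OF I])
qed

text \<open>Directedness serves for sums; scaling and multiplication by a fixed element are bounded
  linear maps that preserve the union and hence its closure.\<close>

lemma closed_ideal_closure_directed_Union:
  fixes F :: "'a::cstar_algebra set set"
  assumes ideals: "\<And>I. I \<in> F \<Longrightarrow> closed_ideal I" and "F \<noteq> {}"
    and dir: "\<And>I J. I \<in> F \<Longrightarrow> J \<in> F \<Longrightarrow> \<exists>K\<in>F. I \<subseteq> K \<and> J \<subseteq> K"
  shows "closed_ideal (closure (\<Union>F))"
proof -
  have lin: "f x \<in> closure (\<Union>F)"
    if "bounded_linear f" "\<And>x. x \<in> \<Union>F \<Longrightarrow> f x \<in> \<Union>F" "x \<in> closure (\<Union>F)" for f :: "'a \<Rightarrow> 'a" and x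
  proof -
    have "f ` closure (\<Union>F) \<subseteq> closure (\<Union>F)"
      by (rule image_closure_subset[OF linear_continuous_on[OF that(1)] closed_closure])
        (use that(2) closure_subset in blast)
    with that(3) show ?thesis by blast
  qed
  have "0 \<in> closure (\<Union>F)"
    using \<open>F \<noteq> {}\<close> closed_idealD(1)[OF ideals] closure_subset by blast
  moreover have "x + y \<in> closure (\<Union>F)" if xy: "x \<in> closure (\<Union>F)" "y \<in> closure (\<Union>F)" for x y
  proof -
    obtain s t where s: "\<And>n. s n \<in> \<Union>F" "s \<longlonglongrightarrow> x" and t: "\<And>n. t n \<in> \<Union>F" "t \<longlonglongrightarrow> y"
      using xy unfolding closure_sequential by blast
    have "s n + t n \<in> \<Union>F" for n
    proof -
      obtain I J where "I \<in> F" "s n \<in> I" "J \<in> F" "t n \<in> J" using s(1)[of n] t(1)[of n] by blast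
      then obtain K where "K \<in> F" "s n \<in> K" "t n \<in> K" using dir by blast
      then show ?thesis using closed_idealD(2)[OF ideals] by blast
    qed
    with tendsto_add[OF s(2) t(2)] show ?thesis
      unfolding closure_sequential by (intro exI[of _ "\<lambda>n. s n + t n"]) simp
  qed
  moreover have "scaleC c x \<in> closure (\<Union>F)" if "x \<in> closure (\<Union>F)" for c x
    by (rule lin[OF bounded_linear_scaleC _ that]) (use closed_idealD(3)[OF ideals] in blast)
  moreover have "a * x \<in> closure (\<Union>F)" if "x \<in> closure (\<Union>F)" for a x
    by (rule lin[OF bounded_linear_mult_right _ that]) (use closed_idealD(5)[OF ideals] in blast)
  moreover have "x * a \<in> closure (\<Union>F)" if "x \<in> closure (\<Union>F)" for a x
    by (rule lin[OF bounded_linear_mult_left _ that]) (use closed_idealD(6)[OF ideals] in blast)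
  ultimately show ?thesis by (simp add: closed_ideal_def)
qed

text \<open>The self-adjoint part of \<open>a'\<close> is as close to \<open>a\<close> as
  \<open>a'\<close> is, because \<open>star\<close> is isometric and fixes \<open>a\<close>.\<close>

lemma self_adjoint_approx:
  assumes I: "closed_ideal I" and "a' \<in> I" "star a = a" "norm (a - a') < \<delta>"
  obtains a'' where "a'' \<in> I" "star a'' = a''" "norm (a - a'') < \<delta>"
proof (rule that)
  show "(1/2) *\<^sub>R (a' + star a') \<in> I"
    by (intro closed_idealD[OF I] closed_ideal_star[OF I] assms)
  show "star ((1/2) *\<^sub>R (a' + star a')) = (1/2) *\<^sub>R (a' + star a')"
    by (simp add: star_scaleR star_add star_star add.commute)
  have "a - (1/2) *\<^sub>R (a' + star a') = (1/2) *\<^sub>R ((a - a') + star (a - a'))"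
    using scaleR_half_double[of a] assms(3)
    by (simp add: star_diff scaleR_right_distrib scaleR_right_diff_distrib algebra_simps)
  then have "norm (a - (1/2) *\<^sub>R (a' + star a')) = norm ((a - a') + star (a - a')) / 2"
    by simp
  also have "\<dots> \<le> norm (a - a')"
    using norm_triangle_ineq[of "a - a'" "star (a - a')"] by simp
  finally show "norm (a - (1/2) *\<^sub>R (a' + star a')) < \<delta>" using assms(4) by linarith
qed

text \<open>Modulo \<open>I\<close> the element \<open>a\<close> equals \<open>a - a''\<close> for a
  self-adjoint \<open>a''\<close> in \<open>I\<close>; this difference has norm below
  \<open>\<delta>\<close>, so truncation leaves it unchanged.\<close>

lemma diff_truncate_mem:
  assumes I: "closed_ideal I" and "a' \<in> I" "star a = a" "norm (a - a') < \<delta>"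
  shows "a - truncate \<delta> a \<in> I"
proof -
  obtain a'' where a'': "a'' \<in> I" "star a'' = a''" "norm (a - a'') < \<delta>"
    by (rule self_adjoint_approx[OF assms])
  have \<delta>: "\<delta> > 0" using a''(3) norm_ge_zero[of "a - a''"] by linarith
  have d: "star (a - a'') = a - a''" using a'' assms by (simp add: star_diff)
  have "truncate \<delta> a - truncate \<delta> (a - a'') \<in> I"
    by (rule truncate_diff_mem[OF I]) (use a'' assms d \<delta> in auto)
  then have "truncate \<delta> a - (a - a'') \<in> I" by (simp only: truncate_eq_self[OF d a''(3)])
  from closed_idealD(9)[OF I a''(1) this] show ?thesis by simp
qed

section \<open>Ideals of the pullback\<close>

text \<open>The map \<alpha> of the theorem on arbitrary sets: it is also applied to single pairs
  and to unions of ideals.\<close>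

definition ideal_pair :: "('a::cstar_algebra \<times> 'b::cstar_algebra) set \<Rightarrow> 'a set \<times> 'b set" where
  "ideal_pair M = (Ideal (fst ` M), Ideal (snd ` M))"

locale pullback_diagram =
  fixes \<phi> :: "'a::cstar_algebra \<Rightarrow> 'c::cstar_algebra" and \<psi> :: "'b::cstar_algebra \<Rightarrow> 'c"
  assumes \<phi>: "star_hom \<phi>" and \<psi>: "star_hom \<psi>" and surj: "surj \<phi>"
begin

lemma continuous_homs: "continuous_on S \<phi>" "continuous_on T \<psi>"
  by (rule linear_continuous_on[OF star_hom_bounded_linear], rule \<phi> \<psi>)+

lemma closed_star_subalgebra_pullback: "closed_star_subalgebra (pullback \<phi> \<psi>)"
proof -
  have "pullback \<phi> \<psi> = {p. \<phi> (fst p) = \<psi> (snd p)}" by (auto simp: pullback_def)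
  moreover have "closed {p. \<phi> (fst p) = \<psi> (snd p)}"
    by (intro closed_Collect_eq continuous_on_compose2[OF continuous_homs(1)]
        continuous_on_compose2[OF continuous_homs(2)] continuous_intros) auto
  ultimately show ?thesis
    unfolding closed_star_subalgebra_def
    by (auto simp: pullback_def star_homD[OF \<phi>] star_homD[OF \<psi>])
qed

lemma pb_closed_idealD:
  assumes "M \<in> Lat_pb \<phi> \<psi>"
  shows "M \<subseteq> pullback \<phi> \<psi>" "closed M" "(0, 0) \<in> M"
    "(a, b) \<in> M \<Longrightarrow> (a', b') \<in> M \<Longrightarrow> (a + a', b + b') \<in> M"
    "(a, b) \<in> M \<Longrightarrow> (scaleC c a, scaleC c b) \<in> M" "(a, b) \<in> M \<Longrightarrow> (- a, - b) \<in> M"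
    "(d, e) \<in> pullback \<phi> \<psi> \<Longrightarrow> (a, b) \<in> M \<Longrightarrow> (d * a, e * b) \<in> M"
    "(d, e) \<in> pullback \<phi> \<psi> \<Longrightarrow> (a, b) \<in> M \<Longrightarrow> (a * d, b * e) \<in> M"
proof -
  have M: "pb_closed_ideal \<phi> \<psi> M" using assms by (simp add: Lat_pb_def)
  then show "M \<subseteq> pullback \<phi> \<psi>" "(0, 0) \<in> M"
    "(a, b) \<in> M \<Longrightarrow> (a', b') \<in> M \<Longrightarrow> (a + a', b + b') \<in> M"
    "(d, e) \<in> pullback \<phi> \<psi> \<Longrightarrow> (a, b) \<in> M \<Longrightarrow> (d * a, e * b) \<in> M"
    "(d, e) \<in> pullback \<phi> \<psi> \<Longrightarrow> (a, b) \<in> M \<Longrightarrow> (a * d, b * e) \<in> M"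
    unfolding pb_closed_ideal_def by blast+
  show sc: "(a, b) \<in> M \<Longrightarrow> (scaleC c a, scaleC c b) \<in> M" for c
    using M unfolding pb_closed_ideal_def by blast
  show "(a, b) \<in> M \<Longrightarrow> (- a, - b) \<in> M" using sc[of "-1"] by (simp add: scaleC_minus_one)
  show "closed M"
    using M closed_star_subalgebraD(1)[OF closed_star_subalgebra_pullback]
    unfolding pb_closed_ideal_def by (meson closedin_closed_trans)
qed

text \<open>As for \<open>closed_ideal_star\<close>, but \<open>M\<close> absorbs only factors from
  the pullback: \<open>R\<close> bounds both coordinates, so that one polynomial \<open>q\<close>
  serves both and the multiplier stays in the pullback.\<close>

lemma pb_closed_ideal_star:
  assumes M: "M \<in> Lat_pb \<phi> \<psi>" and x: "(x1, x2) \<in> M"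
  shows "(star x1, star x2) \<in> M"
proof -
  note P = closed_star_subalgebraD[OF closed_star_subalgebra_pullback]
  have xP: "(x1, x2) \<in> pullback \<phi> \<psi>" using pb_closed_idealD(1)[OF M] x by blast
  have "\<exists>y\<in>M. dist y (star x1, star x2) < e" if e: "e > 0" for e
  proof -
    define R where "R = norm x1 ^ 2 + norm x2 ^ 2 + 1"
    have R: "R > 0" "norm x1 ^ 2 < R" "norm x2 ^ 2 < R"
      by (simp_all add: R_def add_nonneg_pos add_pos_nonneg)
    obtain q where q: "\<forall>t. \<bar>t\<bar> \<le> R \<longrightarrow> \<bar>t * (poly (pCons 1 q) t * poly (pCons 1 q) t)\<bar> \<le> (e/3)\<^sup>2"
      using approximate_unit_poly[of R "(e/3)\<^sup>2"] R e by auto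
    define w1 where "w1 = poly_op q ((*) (star x1 * x1)) (star x1)"
    define w2 where "w2 = poly_op q ((*) (star x2 * x2)) (star x2)"
    have "poly_op q (map_prod ((*) (star x1 * x1)) ((*) (star x2 * x2))) (star x1, star x2) \<in> pullback \<phi> \<psi>"
    proof (rule poly_op_mem)
      show "linear (map_prod ((*) (star x1 * x1)) ((*) (star x2 * x2)))"
        by (rule linearI) (auto simp: distrib_left)
    qed (use xP P in \<open>auto simp: zero_prod_def\<close>)
    then have w: "(w1, w2) \<in> pullback \<phi> \<psi>"
      by (simp add: poly_op_map_prod linear_mult_left w1_def w2_def)
    have "(- (star x1 * x1 * w1), - (star x2 * x2 * w2)) \<in> M"
      by (intro pb_closed_idealD(6-8)[OF M] w P xP x)
    moreover have "dist (- (star x1 * x1 * w1), - (star x2 * x2 * w2)) (star x1, star x2) < e"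
    proof -
      have "norm (star x1 + star x1 * x1 * w1) \<le> e/3" "norm (star x2 + star x2 * x2 * w2) \<le> e/3"
        unfolding w1_def w2_def
        by (rule norm_approximate_unit_le[OF R(2) q] norm_approximate_unit_le[OF R(3) q], use e in simp)+
      then have "dist (- (star x1 * x1 * w1)) (star x1) \<le> e/3" "dist (- (star x2 * x2 * w2)) (star x2) \<le> e/3"
        by (simp_all add: dist_norm norm_minus_commute[of "- _" "star _"])
      moreover have "dist (- (star x1 * x1 * w1), - (star x2 * x2 * w2)) (star x1, star x2)
         \<le> dist (- (star x1 * x1 * w1)) (star x1) + dist (- (star x2 * x2 * w2)) (star x2)"
        unfolding dist_Pair_Pair by (rule sqrt_sum_squares_le_sum) simp_all
      ultimately show ?thesis using e by linarith
    qed
    ultimately show ?thesis by blast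
  qed
  then show ?thesis using closed_approachable[OF pb_closed_idealD(2)[OF M]] by blast
qed

lemma closed_star_subalgebra_pb_ideal:
  assumes M: "M \<in> Lat_pb \<phi> \<psi>"
  shows "closed_star_subalgebra M"
proof -
  have "(x1 * y1, x2 * y2) \<in> M" if "(x1, x2) \<in> M" "(y1, y2) \<in> M" for x1 x2 y1 y2
    by (rule pb_closed_idealD(7)[OF M subsetD[OF pb_closed_idealD(1)[OF M] that(1)] that(2)])
  then show ?thesis
    unfolding closed_star_subalgebra_def
    by (intro conjI ballI; clarsimp simp: pb_closed_idealD(2-5)[OF M] pb_closed_ideal_star[OF M])
qed

text \<open>Surjectivity of \<open>\<phi>\<close> extends any \<open>c\<close> to a multiplier
  \<open>(d, c)\<close> in the pullback. The first projection need not be an ideal, as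
  \<open>\<psi>\<close> need not be surjective.\<close>

lemma closed_ideal_snd_image:
  assumes M: "M \<in> Lat_pb \<phi> \<psi>"
  shows "closed_ideal (snd ` M)"
proof -
  have "c * b \<in> snd ` M \<and> b * c \<in> snd ` M" if "(a, b) \<in> M" for a b c
  proof -
    obtain d where "\<phi> d = \<psi> c" using surj by (metis surjD)
    then have "(d, c) \<in> pullback \<phi> \<psi>" by (simp add: pullback_def)
    then have "(d * a, c * b) \<in> M" "(a * d, b * c) \<in> M" using pb_closed_idealD(7,8)[OF M] that by auto
    then show ?thesis by force
  qed
  moreover have "0 \<in> snd ` M" using pb_closed_idealD(3)[OF M] by force
  moreover have "b + b' \<in> snd ` M" if "(a, b) \<in> M" "(a', b') \<in> M" for a b a' b'
    using pb_closed_idealD(4)[OF M that] by force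
  moreover have "scaleC c b \<in> snd ` M" if "(a, b) \<in> M" for a b c
    using pb_closed_idealD(5)[OF M that, of c] by force
  ultimately show ?thesis
    unfolding closed_ideal_def
    by (intro conjI ballI allI; clarsimp simp: closed_snd_image[OF closed_star_subalgebra_pb_ideal[OF M]])
qed

text \<open>For \<open>u, w\<close> in the kernel of \<open>\<phi>\<close>, multiplication by \<open>(u, 0)\<close> and \<open>(w, 0)\<close> moves \<open>fst ` M\<close> into
  the set of all \<open>x\<close> with \<open>(x, 0) \<in> M\<close>; triple products then suffice.\<close>

lemma ker_mem_pb_ideal:
  assumes M: "M \<in> Lat_pb \<phi> \<psi>" and x: "x \<in> Ideal (fst ` M)" "\<phi> x = 0"
  shows "(x, 0) \<in> M"
proof -
  define D where "D = \<Inter>{Ideal (fst ` M), \<phi> -` {0}}"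
  have "closed_ideal {0 :: 'c}" by (simp add: closed_ideal_def)
  then have D: "closed_ideal D"
    unfolding D_def by (intro closed_ideal_Inter) (auto intro: closed_ideal_Ideal closed_ideal_vimage[OF \<phi>])
  define V where "V = {v. \<forall>u w. \<phi> u = 0 \<longrightarrow> \<phi> w = 0 \<longrightarrow> (u * v * w, 0) \<in> M}"
  have "V = (\<Inter>u\<in>{u. \<phi> u = 0}. \<Inter>w\<in>{u. \<phi> u = 0}. (\<lambda>v. (u * v * w, 0)) -` M)"
    by (auto simp: V_def)
  moreover have "closed ((\<lambda>v. (u * v * w, 0)) -` M)" for u w
    by (intro closed_vimage pb_closed_idealD(2)[OF M] continuous_intros)
  ultimately have "closed V" by (auto intro!: closed_INT)
  moreover have "v + v' \<in> V" if "v \<in> V" "v' \<in> V" for v v'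
    using that pb_closed_idealD(4)[OF M, of _ 0 _ 0] by (auto simp: V_def distrib_left distrib_right)
  moreover have "scaleC c v \<in> V" if "v \<in> V" for c v
    using that pb_closed_idealD(5)[OF M, of _ 0 c]
    by (auto simp: V_def mult_scaleC_left mult_scaleC_right)
  \<comment> \<open>\<open>u * a\<close> and \<open>a * w\<close> are again in the kernel of
    \<open>\<phi>\<close>.\<close>
  moreover have "a * v \<in> V \<and> v * a \<in> V" if v: "v \<in> V" for a v
  proof -
    have "(u * a * v * w, 0) \<in> M" "(u * v * (a * w), 0) \<in> M" if "\<phi> u = 0" "\<phi> w = 0" for u w
      using v that by (auto simp: V_def star_homD[OF \<phi>])
    then show ?thesis by (simp add: V_def mult.assoc)
  qed
  ultimately have V: "closed_ideal V"
    unfolding closed_ideal_def using pb_closed_idealD(3)[OF M] by (auto simp: V_def)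
  have "fst ` M \<subseteq> V"
  proof safe
    fix a b assume ab: "(a, b) \<in> M"
    have "(u * a * w, 0 * b * 0) \<in> M" if "\<phi> u = 0" "\<phi> w = 0" for u w
      by (intro pb_closed_idealD(7,8)[OF M] ab)
        (use that in \<open>auto simp: pullback_def star_homD[OF \<psi>]\<close>)
    then show "fst (a, b) \<in> V" by (simp add: V_def)
  qed
  with V have IV: "Ideal (fst ` M) \<subseteq> V" by (rule Ideal_least)
  have "D \<subseteq> (\<lambda>x. (x, 0)) -` M"
  proof (rule closed_ideal_subset_if_triple_products[OF D])
    show "closed ((\<lambda>x. (x, 0)) -` M)"
      by (intro closed_vimage pb_closed_idealD(2)[OF M] continuous_intros)
    show "u * v * w \<in> (\<lambda>x. (x, 0)) -` M" if "u \<in> D" "v \<in> D" "w \<in> D" for u v w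
      using that IV by (auto simp: D_def V_def)
  qed
  moreover have "x \<in> D" using x by (simp add: D_def)
  ultimately show ?thesis by blast
qed

section \<open>The correspondence between ideals of the pullback and pairs in
  \<open>L_AB\<close>\<close>

definition pair_ideal :: "'a set \<times> 'b set \<Rightarrow> ('a \<times> 'b) set" where
  "pair_ideal = (\<lambda>(I, J). {(a, b) \<in> pullback \<phi> \<psi>. a \<in> I \<and> b \<in> J})"

text \<open>Preimages of closed ideals are closed ideals, so the inclusions need only be checked on
  the generators, where \<open>\<phi> a = \<psi> b\<close>. Surjectivity makes the image of
  \<open>I\<close> a closed ideal.\<close>

lemma ideal_pair_mem_L_AB:
  assumes S: "S \<subseteq> pullback \<phi> \<psi>"
  shows "ideal_pair S \<in> L_AB \<phi> \<psi>"
proof -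
  define I where "I = Ideal (fst ` S)"
  define J where "J = Ideal (snd ` S)"
  have I: "closed_ideal I" and J: "closed_ideal J"
    by (simp_all add: I_def J_def closed_ideal_Ideal)
  have \<phi>I: "closed_ideal (\<phi> ` I)" by (rule closed_ideal_image[OF \<phi> surj I])
  have eq: "\<phi> a = \<psi> b" if "(a, b) \<in> S" for a b using S that by (auto simp: pullback_def)
  have SI: "a \<in> I" "b \<in> J" if "(a, b) \<in> S" for a b
    using that subset_Ideal[of "fst ` S"] subset_Ideal[of "snd ` S"] by (force simp: I_def J_def)+
  have "J \<subseteq> \<psi> -` (\<phi> ` I)"
    unfolding J_def
    by (rule Ideal_least[OF closed_ideal_vimage[OF \<psi> \<phi>I]])
      (use eq[symmetric] SI in auto)
  then have 1: "Ideal (\<psi> ` J) \<subseteq> \<phi> ` I" by (intro Ideal_least[OF \<phi>I]) auto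
  have "I \<subseteq> \<phi> -` Ideal (\<psi> ` J)"
    unfolding I_def
  proof (rule Ideal_least[OF closed_ideal_vimage[OF \<phi> closed_ideal_Ideal]])
    show "fst ` S \<subseteq> \<phi> -` Ideal (\<psi> ` J)"
      using eq SI(2) subset_Ideal[of "\<psi> ` J"] by force
  qed
  with 1 have "\<phi> ` I = Ideal (\<psi> ` J)" by blast
  moreover have "Ideal (I \<inter> \<phi> -` (\<psi> ` J)) = I"
  proof (rule antisym)
    show "Ideal (I \<inter> \<phi> -` (\<psi> ` J)) \<subseteq> I" by (rule Ideal_least[OF I]) blast
    have "fst ` S \<subseteq> I \<inter> \<phi> -` (\<psi> ` J)" using eq SI by force
    then show "I \<subseteq> Ideal (I \<inter> \<phi> -` (\<psi> ` J))" unfolding I_def by (rule Ideal_mono)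
  qed
  ultimately show ?thesis
    using I J by (simp add: L_AB_def Lat_def ideal_pair_def I_def J_def)
qed

lemma pair_ideal_ideal_pair:
  assumes M: "M \<in> Lat_pb \<phi> \<psi>"
  shows "pair_ideal (ideal_pair M) = M"
proof
  show "M \<subseteq> pair_ideal (ideal_pair M)"
    using pb_closed_idealD(1)[OF M] subset_Ideal[of "fst ` M"] subset_Ideal[of "snd ` M"]
    by (force simp: pair_ideal_def ideal_pair_def)
  show "pair_ideal (ideal_pair M) \<subseteq> M"
  proof
    fix p assume "p \<in> pair_ideal (ideal_pair M)"
    then obtain a b where p: "p = (a, b)" "\<phi> a = \<psi> b" "a \<in> Ideal (fst ` M)" "b \<in> Ideal (snd ` M)"
      by (auto simp: pair_ideal_def ideal_pair_def pullback_def)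
    \<comment> \<open>The second projection of \<open>M\<close> is already a closed ideal, so
      \<open>b\<close> has a partner \<open>a'\<close> with \<open>(a', b)\<close> in
      \<open>M\<close>; the remainder \<open>a - a'\<close> lies in the kernel of
      \<open>\<phi>\<close>.\<close>
    then have "b \<in> snd ` M" by (simp add: Ideal_eq_self[OF closed_ideal_snd_image[OF M]])
    then obtain a' where a': "(a', b) \<in> M" by force
    then have "\<phi> a' = \<psi> b" "a' \<in> Ideal (fst ` M)"
      using pb_closed_idealD(1)[OF M] subset_Ideal[of "fst ` M"] by (force simp: pullback_def)+
    then have "(a - a', 0) \<in> M"
      using p by (intro ker_mem_pb_ideal[OF M] closed_idealD[OF closed_ideal_Ideal])
        (simp_all add: star_homD[OF \<phi>])
    from pb_closed_idealD(4)[OF M this a'] show "p \<in> M" by (simp add: p)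
  qed
qed

lemma L_ABD:
  assumes "(I, J) \<in> L_AB \<phi> \<psi>"
  shows "closed_ideal I" "closed_ideal J" "\<phi> ` I = Ideal (\<psi> ` J)" "Ideal (I \<inter> \<phi> -` (\<psi> ` J)) = I"
  using assms by (auto simp: L_AB_def Lat_def)

lemma pair_ideal_mem_Lat_pb:
  assumes "p \<in> L_AB \<phi> \<psi>"
  shows "pair_ideal p \<in> Lat_pb \<phi> \<psi>"
proof -
  obtain I J where p: "p = (I, J)" by (cases p)
  note IJ = L_ABD(1,2)[OF assms[unfolded p]]
  have "pair_ideal p = pullback \<phi> \<psi> \<inter> (I \<times> J)" by (auto simp: p pair_ideal_def)
  moreover have "closed (I \<times> J)" by (intro closed_Times closed_idealD IJ)
  ultimately have "closedin (top_of_set (pullback \<phi> \<psi>)) (pair_ideal p)"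
    by (simp add: closedin_closed_Int)
  then show ?thesis
    using closed_star_subalgebraD[OF closed_star_subalgebra_pullback]
    by (auto simp: Lat_pb_def pb_closed_ideal_def p pair_ideal_def
        intro: closed_idealD[OF IJ(1)] closed_idealD[OF IJ(2)])
qed

text \<open>Condition (1) matches every \<open>b\<close> in \<open>J\<close> with some
  \<open>a\<close> in \<open>I\<close>, so the second projection is all of \<open>J\<close>;
  condition (2) says that the first projection generates \<open>I\<close>.\<close>

lemma ideal_pair_pair_ideal:
  assumes "p \<in> L_AB \<phi> \<psi>"
  shows "ideal_pair (pair_ideal p) = p"
proof -
  obtain I J where p: "p = (I, J)" by (cases p)
  note IJ = L_ABD[OF assms[unfolded p]]
  have "fst ` pair_ideal p = I \<inter> \<phi> -` (\<psi> ` J)"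
    by (force simp: p pair_ideal_def pullback_def)
  moreover have "snd ` pair_ideal p = J"
  proof safe
    fix b assume b: "b \<in> J"
    then have "\<psi> b \<in> \<phi> ` I" using IJ(3) subset_Ideal[of "\<psi> ` J"] by blast
    then obtain a where "a \<in> I" "\<phi> a = \<psi> b" by auto
    with b have "(a, b) \<in> pair_ideal p" by (simp add: p pair_ideal_def pullback_def)
    then show "b \<in> snd ` pair_ideal p" by force
  qed (auto simp: p pair_ideal_def)
  ultimately show ?thesis by (simp add: ideal_pair_def IJ(4) Ideal_eq_self[OF IJ(2)] p)
qed

end

section \<open>Suprema and the way-below relation\<close>

lemma pair_le_trans: "pair_le p q \<Longrightarrow> pair_le q r \<Longrightarrow> pair_le p r"
  by (auto simp: pair_le_def)

lemma way_belowD: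
  fixes x y :: 'x and J :: "'x set"
  assumes "way_below le S x y" "directed_on J r" "f ` J \<subseteq> S"
    "\<forall>i\<in>J. \<forall>j\<in>J. r i j \<longrightarrow> le (f i) (f j)" "is_lub le S (f ` J) s" "le y s"
  shows "\<exists>j\<in>J. le x (f j)"
  by (rule assms(1)[unfolded way_below_def, rule_format, of J r f]) (intro conjI exI[of _ s] assms(2-))

lemma way_belowI:
  fixes x y :: 'x
  assumes "\<And>(J :: 'x set) r f s. directed_on J r \<Longrightarrow> f ` J \<subseteq> S \<Longrightarrow>
    \<forall>i\<in>J. \<forall>j\<in>J. r i j \<longrightarrow> le (f i) (f j) \<Longrightarrow> is_lub le S (f ` J) s \<Longrightarrow> le y s \<Longrightarrow> \<exists>j\<in>J. le x (f j)"
  shows "way_below le S x y"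
  unfolding way_below_def by (intro allI impI, elim conjE exE) (rule assms)

lemma is_lub_Lat_Times_Lat:
  "is_lub pair_le (Lat \<times> Lat) T (Ideal (\<Union>(fst ` T)), Ideal (\<Union>(snd ` T)))"
  unfolding is_lub_def
proof (intro conjI ballI impI)
  show "(Ideal (\<Union>(fst ` T)), Ideal (\<Union>(snd ` T))) \<in> Lat \<times> Lat"
    by (simp add: Lat_def closed_ideal_Ideal)
  show "pair_le t (Ideal (\<Union>(fst ` T)), Ideal (\<Union>(snd ` T)))" if "t \<in> T" for t
    using that subset_Ideal[of "\<Union>(fst ` T)"] subset_Ideal[of "\<Union>(snd ` T)"]
    by (auto simp: pair_le_def)
  show "pair_le (Ideal (\<Union>(fst ` T)), Ideal (\<Union>(snd ` T))) u"
    if "u \<in> Lat \<times> Lat" "\<forall>t\<in>T. pair_le t u" for u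
  proof -
    have "\<Union>(fst ` T) \<subseteq> fst u" "\<Union>(snd ` T) \<subseteq> snd u" using that(2) by (auto simp: pair_le_def)
    moreover have "closed_ideal (fst u)" "closed_ideal (snd u)" using that(1) by (auto simp: Lat_def)
    ultimately show ?thesis by (simp add: pair_le_def Ideal_least)
  qed
qed

text \<open>Tested on the constant net at \<open>q\<close>.\<close>

lemma way_below_imp_le:
  assumes "way_below pair_le S p q" "q \<in> S"
  shows "pair_le p q"
proof -
  have refl: "pair_le q q" by (simp add: pair_le_def)
  have "\<exists>j\<in>{q}. pair_le p ((\<lambda>_. q) j)"
    by (rule way_belowD[OF assms(1), where r = "\<lambda>_ _. True" and s = q])
      (use assms(2) refl in \<open>auto simp: directed_on_def is_lub_def\<close>)
  then show ?thesis by simp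
qed

lemma way_below_lub_pair:
  fixes p1 p2 q s :: "'a set \<times> 'b set"
  assumes "way_below pair_le S p1 q" "way_below pair_le S p2 q" "is_lub pair_le S {p1, p2} s"
  shows "way_below pair_le S s q"
proof (rule way_belowI)
  fix J :: "('a set \<times> 'b set) set" and r and f :: "'a set \<times> 'b set \<Rightarrow> 'a set \<times> 'b set" and t
  assume net: "directed_on J r" "f ` J \<subseteq> S" "\<forall>i\<in>J. \<forall>j\<in>J. r i j \<longrightarrow> pair_le (f i) (f j)"
    "is_lub pair_le S (f ` J) t" "pair_le q t"
  obtain i where i: "i \<in> J" "pair_le p1 (f i)"
    using way_belowD[OF assms(1) net] by blast
  obtain j where j: "j \<in> J" "pair_le p2 (f j)"
    using way_belowD[OF assms(2) net] by blast
  obtain k where k: "k \<in> J" "r i k" "r j k"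
    using net(1) i j unfolding directed_on_def by blast
  then have "pair_le (f i) (f k)" "pair_le (f j) (f k)" using net(3) i(1) j(1) by simp_all
  then have "pair_le p1 (f k)" "pair_le p2 (f k)"
    using pair_le_trans[OF i(2)] pair_le_trans[OF j(2)] by simp_all
  moreover have "f k \<in> S" using net(2) k by blast
  ultimately have "pair_le s (f k)" using assms(3) by (auto simp: is_lub_def)
  with k show "\<exists>j\<in>J. pair_le s (f j)" by blast
qed

text \<open>A self-adjoint element \<open>a\<close> of the closure of a directed union of ideals is within \<open>\<delta>\<close> of one of
  them, and then \<open>a - truncate \<delta> a\<close> already lies in that ideal.\<close>

lemma way_below_Ideal_diff_truncate:
  fixes a :: "'a::cstar_algebra" and b :: "'b::cstar_algebra"
  assumes ab: "a \<in> I" "b \<in> J" "star a = a" "star b = b" and \<delta>: "\<delta> > 0"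
  shows "way_below pair_le (Lat \<times> Lat) (Ideal {a - truncate \<delta> a}, Ideal {b - truncate \<delta> b}) (I, J)"
proof (rule way_belowI)
  fix K :: "('a set \<times> 'b set) set" and r and f :: "'a set \<times> 'b set \<Rightarrow> 'a set \<times> 'b set" and s
  assume net: "directed_on K r" "f ` K \<subseteq> Lat \<times> Lat" "\<forall>i\<in>K. \<forall>j\<in>K. r i j \<longrightarrow> pair_le (f i) (f j)"
    and s: "is_lub pair_le (Lat \<times> Lat) (f ` K) s" "pair_le (I, J) s"
  have ideals: "closed_ideal (fst (f k))" "closed_ideal (snd (f k))" if "k \<in> K" for k
  proof -
    have "f k \<in> Lat \<times> Lat" by (rule subsetD[OF net(2) imageI[OF that]])
    then show "closed_ideal (fst (f k))" "closed_ideal (snd (f k))" by (simp_all add: mem_Times_iff Lat_def)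
  qed
  have "K \<noteq> {}" using net(1) unfolding directed_on_def by (elim conjE)
  have dir: "\<exists>k\<in>K. pair_le (f i) (f k) \<and> pair_le (f j) (f k)" if "i \<in> K" "j \<in> K" for i j
  proof -
    have "\<forall>i\<in>K. \<forall>j\<in>K. \<exists>k\<in>K. r i k \<and> r j k"
      using net(1) unfolding directed_on_def by (elim conjE)
    from bspec[OF bspec[OF this that(1)] that(2)] obtain k where "k \<in> K" "r i k" "r j k" by auto
    then show ?thesis using net(3) that by (intro bexI[of _ k]) simp_all
  qed
  define A where "A = closure (\<Union>k\<in>K. fst (f k))"
  define B where "B = closure (\<Union>k\<in>K. snd (f k))"
  have "closed_ideal A"
    unfolding A_def
  proof (rule closed_ideal_closure_directed_Union)
    fix I J assume "I \<in> (\<lambda>k. fst (f k)) ` K" "J \<in> (\<lambda>k. fst (f k)) ` K"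
    then obtain i j where ij: "i \<in> K" "I = fst (f i)" "j \<in> K" "J = fst (f j)" by blast
    obtain k where "k \<in> K" "pair_le (f i) (f k)" "pair_le (f j) (f k)" using dir[OF ij(1,3)] by blast
    then show "\<exists>L\<in>(\<lambda>k. fst (f k)) ` K. I \<subseteq> L \<and> J \<subseteq> L"
      by (intro bexI[of _ "fst (f k)"]) (simp_all add: ij(2,4) pair_le_def)
  next
    show "(\<lambda>k. fst (f k)) ` K \<noteq> {}" using \<open>K \<noteq> {}\<close> by simp
    show "closed_ideal I" if "I \<in> (\<lambda>k. fst (f k)) ` K" for I using that ideals by blast
  qed
  moreover have "closed_ideal B"
    unfolding B_def
  proof (rule closed_ideal_closure_directed_Union)
    fix I J assume "I \<in> (\<lambda>k. snd (f k)) ` K" "J \<in> (\<lambda>k. snd (f k)) ` K"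
    then obtain i j where ij: "i \<in> K" "I = snd (f i)" "j \<in> K" "J = snd (f j)" by blast
    obtain k where "k \<in> K" "pair_le (f i) (f k)" "pair_le (f j) (f k)" using dir[OF ij(1,3)] by blast
    then show "\<exists>L\<in>(\<lambda>k. snd (f k)) ` K. I \<subseteq> L \<and> J \<subseteq> L"
      by (intro bexI[of _ "snd (f k)"]) (simp_all add: ij(2,4) pair_le_def)
  next
    show "(\<lambda>k. snd (f k)) ` K \<noteq> {}" using \<open>K \<noteq> {}\<close> by simp
    show "closed_ideal I" if "I \<in> (\<lambda>k. snd (f k)) ` K" for I using that ideals by blast
  qed
  moreover have "pair_le (f k) (A, B)" if "k \<in> K" for k
  proof -
    have "fst (f k) \<subseteq> (\<Union>k\<in>K. fst (f k))" "snd (f k) \<subseteq> (\<Union>k\<in>K. snd (f k))" using that by blast+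
    then show ?thesis
      unfolding pair_le_def A_def B_def fst_conv snd_conv by (intro conjI subset_trans[OF _ closure_subset])
  qed
  ultimately have "(A, B) \<in> Lat \<times> Lat" "\<forall>t\<in>f ` K. pair_le t (A, B)"
    by (simp_all add: Lat_def)
  then have "pair_le s (A, B)" using s(1) unfolding is_lub_def by blast
  with s(2) have "I \<subseteq> A" "J \<subseteq> B" by (auto simp: pair_le_def)
  with ab have mem: "a \<in> A" "b \<in> B" by blast+
  from mem(1) obtain a' where "a' \<in> (\<Union>k\<in>K. fst (f k))" "dist a' a < \<delta>"
    unfolding A_def closure_approachable using \<delta> by blast
  then obtain i where i: "i \<in> K" "a' \<in> fst (f i)" "norm (a - a') < \<delta>"
    by (auto simp: dist_norm norm_minus_commute)
  from mem(2) obtain b' where "b' \<in> (\<Union>k\<in>K. snd (f k))" "dist b' b < \<delta>"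
    unfolding B_def closure_approachable using \<delta> by blast
  then obtain j where j: "j \<in> K" "b' \<in> snd (f j)" "norm (b - b') < \<delta>"
    by (auto simp: dist_norm norm_minus_commute)
  obtain k where k: "k \<in> K" "pair_le (f i) (f k)" "pair_le (f j) (f k)" using dir i j by blast
  have "a' \<in> fst (f k)" "b' \<in> snd (f k)" using i j k by (auto simp: pair_le_def)
  then have "a - truncate \<delta> a \<in> fst (f k)" "b - truncate \<delta> b \<in> snd (f k)"
    using diff_truncate_mem[OF ideals(1)[OF k(1)] _ ab(3) i(3)]
      diff_truncate_mem[OF ideals(2)[OF k(1)] _ ab(4) j(3)] by simp_all
  then have "pair_le (Ideal {a - truncate \<delta> a}, Ideal {b - truncate \<delta> b}) (f k)"
    using ideals[OF k(1)] by (simp add: pair_le_def Ideal_least)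
  with k(1) show "\<exists>j\<in>K. pair_le (Ideal {a - truncate \<delta> a}, Ideal {b - truncate \<delta> b}) (f j)" by blast
qed

text \<open>By \<open>norm_truncate_le\<close>, \<open>a - truncate \<delta> a\<close> tends to
  \<open>a\<close> as \<open>\<delta>\<close> goes to 0.\<close>

lemma mem_if_diff_truncate_mem:
  assumes "closed_ideal I" "star a = a" "\<And>\<delta>. \<delta> > 0 \<Longrightarrow> a - truncate \<delta> a \<in> I"
  shows "a \<in> I"
proof -
  have "\<exists>y\<in>I. dist y a < e" if "e > 0" for e
  proof
    show "a - truncate (e/2) a \<in> I" using assms(3) that by simp
    show "dist (a - truncate (e/2) a) a < e"
      using norm_truncate_le[OF assms(2), of "e/2"] that by (simp add: dist_norm)
  qed
  then show ?thesis using closed_approachable[OF closed_idealD(7)[OF assms(1)]] by blast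
qed

section \<open>Comparison of \<open>L_AB\<close> with \<open>Lat \<times> Lat\<close>\<close>

context pullback_diagram
begin

lemma L_AB_subset: "L_AB \<phi> \<psi> \<subseteq> Lat \<times> Lat"
  by (auto simp: L_AB_def)

lemma is_lub_L_ABI:
  assumes "is_lub pair_le (Lat \<times> Lat) T s" "s \<in> L_AB \<phi> \<psi>"
  shows "is_lub pair_le (L_AB \<phi> \<psi>) T s"
proof -
  have "pair_le s u" if "u \<in> L_AB \<phi> \<psi>" "\<forall>t\<in>T. pair_le t u" for u
    using assms(1) subsetD[OF L_AB_subset that(1)] that(2) unfolding is_lub_def by blast
  then show ?thesis using assms unfolding is_lub_def by blast
qed

text \<open>The componentwise supremum is the ideal pair of the union \<open>S\<close> of the
  corresponding ideals of the pullback, and every subset of the pullback generates a pair in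
  \<open>L_AB\<close>.\<close>

lemma Sup_mem_L_AB:
  assumes T: "T \<subseteq> L_AB \<phi> \<psi>"
  shows "(Ideal (\<Union>(fst ` T)), Ideal (\<Union>(snd ` T))) \<in> L_AB \<phi> \<psi>"
proof -
  define S where "S = (\<Union>t\<in>T. pair_ideal t)"
  have t: "t = ideal_pair (pair_ideal t)" if "t \<in> T" for t
    by (rule ideal_pair_pair_ideal[OF subsetD[OF T that], symmetric])
  have "Ideal (\<Union>(fst ` T)) = Ideal (fst ` S)"
  proof (intro antisym Ideal_least closed_ideal_Ideal)
    show "\<Union>(fst ` T) \<subseteq> Ideal (fst ` S)"
    proof (intro UN_least)
      fix t assume "t \<in> T"
      then have "fst t = Ideal (fst ` pair_ideal t)" 
        using arg_cong[OF t, of t fst] by (simp only: ideal_pair_def fst_conv)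
      also have "\<dots> \<subseteq> Ideal (fst ` S)" using \<open>t \<in> T\<close> by (intro Ideal_mono) (auto simp: S_def)
      finally show "fst t \<subseteq> Ideal (fst ` S)" .
    qed
    have "fst ` S \<subseteq> \<Union>(fst ` T)" by (auto simp: S_def pair_ideal_def split_beta)
    then show "fst ` S \<subseteq> Ideal (\<Union>(fst ` T))" using subset_Ideal by (rule subset_trans)
  qed
  moreover have "Ideal (\<Union>(snd ` T)) = Ideal (snd ` S)"
  proof (intro antisym Ideal_least closed_ideal_Ideal)
    show "\<Union>(snd ` T) \<subseteq> Ideal (snd ` S)"
    proof (intro UN_least)
      fix t assume "t \<in> T"
      then have "snd t = Ideal (snd ` pair_ideal t)" 
        using arg_cong[OF t, of t snd] by (simp only: ideal_pair_def snd_conv)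
      also have "\<dots> \<subseteq> Ideal (snd ` S)" using \<open>t \<in> T\<close> by (intro Ideal_mono) (auto simp: S_def)
      finally show "snd t \<subseteq> Ideal (snd ` S)" .
    qed
    have "snd ` S \<subseteq> \<Union>(snd ` T)" by (auto simp: S_def pair_ideal_def split_beta)
    then show "snd ` S \<subseteq> Ideal (\<Union>(snd ` T))" using subset_Ideal by (rule subset_trans)
  qed
  moreover have "S \<subseteq> pullback \<phi> \<psi>" by (auto simp: S_def pair_ideal_def)
  then have "ideal_pair S \<in> L_AB \<phi> \<psi>" by (rule ideal_pair_mem_L_AB)
  ultimately show ?thesis by (simp add: ideal_pair_def)
qed

text \<open>Both suprema are the componentwise one, and suprema are unique.\<close>

lemma is_lub_L_AB:
  assumes T: "T \<subseteq> L_AB \<phi> \<psi>"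
  shows "is_lub pair_le (L_AB \<phi> \<psi>) T s \<longleftrightarrow> is_lub pair_le (Lat \<times> Lat) T s"
proof -
  define s0 where "s0 = (Ideal (\<Union>(fst ` T)), Ideal (\<Union>(snd ` T)))"
  have 1: "is_lub pair_le (Lat \<times> Lat) T s0" unfolding s0_def by (rule is_lub_Lat_Times_Lat)
  have 2: "is_lub pair_le (L_AB \<phi> \<psi>) T s0"
    using 1 Sup_mem_L_AB[OF T] unfolding s0_def by (rule is_lub_L_ABI)
  have uniq: "s = t" if "is_lub pair_le S T s" "is_lub pair_le S T t" for S s t
  proof -
    have "pair_le s t" "pair_le t s" using that by (auto simp: is_lub_def)
    then show ?thesis by (auto simp: pair_le_def prod_eq_iff)
  qed
  show ?thesis using uniq[of "Lat \<times> Lat" s s0] uniq[of "L_AB \<phi> \<psi>" s s0] 1 2 by auto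
qed

text \<open>A net in \<open>L_AB\<close> is a net in \<open>Lat \<times> Lat\<close> with the same
  supremum.\<close>

lemma way_below_L_AB_if:
  assumes "way_below pair_le (Lat \<times> Lat) p q"
  shows "way_below pair_le (L_AB \<phi> \<psi>) p q"
proof (rule way_belowI)
  fix K :: "('a set \<times> 'b set) set" and r f s
  assume net: "directed_on K r" "f ` K \<subseteq> L_AB \<phi> \<psi>" "\<forall>i\<in>K. \<forall>j\<in>K. r i j \<longrightarrow> pair_le (f i) (f j)"
    and s: "is_lub pair_le (L_AB \<phi> \<psi>) (f ` K) s" "pair_le q s"
  from net(2) have sub: "f ` K \<subseteq> Lat \<times> Lat" using L_AB_subset by (rule subset_trans)
  from s(1) have "is_lub pair_le (Lat \<times> Lat) (f ` K) s" by (simp only: is_lub_L_AB[OF net(2)])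
  from way_belowD[OF assms net(1) sub net(3) this s(2)] show "\<exists>j\<in>K. pair_le p (f j)" .
qed

text \<open>Way-below is taken in the larger lattice, where
  \<open>way_below_Ideal_diff_truncate\<close> provides it; that the relation of \<open>L_AB\<close>
  gives the same set is a consequence, by \<open>way_below_L_AB_iff\<close>.\<close>

definition approximants :: "'a set \<times> 'b set \<Rightarrow> ('a set \<times> 'b set) set" where
  "approximants q = {p \<in> L_AB \<phi> \<psi>. way_below pair_le (Lat \<times> Lat) p q}"

text \<open>For self-adjoint \<open>(a, b)\<close> in the ideal of \<open>q\<close>, the pair
  generated by \<open>a - truncate \<delta> a\<close> and \<open>b - truncate \<delta> b\<close> is
  an approximant. Letting \<open>\<delta>\<close> tend to 0 and then splitting into self-adjoint
  parts places every element of that ideal coordinatewise in \<open>u\<close>.\<close>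

lemma approximants_le:
  assumes q: "q \<in> L_AB \<phi> \<psi>" and u: "u \<in> Lat \<times> Lat" "\<forall>p\<in>approximants q. pair_le p u"
  shows "pair_le q u"
proof -
  obtain I J where IJ: "q = (I, J)" by (cases q)
  obtain I0 J0 where u0: "u = (I0, J0)" by (cases u)
  have ideals: "closed_ideal I0" "closed_ideal J0" using u(1) by (auto simp: u0 Lat_def)
  define M where "M = pair_ideal q"
  have M: "M \<in> Lat_pb \<phi> \<psi>" unfolding M_def by (rule pair_ideal_mem_Lat_pb[OF q])
  note M' = closed_star_subalgebra_pb_ideal[OF M]
  have sa: "a \<in> I0 \<and> b \<in> J0" if ab: "(a, b) \<in> M" "star a = a" "star b = b" for a b
  proof -
    have "a - truncate \<delta> a \<in> I0 \<and> b - truncate \<delta> b \<in> J0" if \<delta>: "\<delta> > 0" for \<delta>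
    proof -
      define x where "x = (Ideal {a - truncate \<delta> a}, Ideal {b - truncate \<delta> b})"
      have "(a - truncate \<delta> a, b - truncate \<delta> b) \<in> M"
        by (intro closed_star_subalgebraD[OF M'] truncate_mem[OF M'] ab \<delta>)
      then have "ideal_pair {(a - truncate \<delta> a, b - truncate \<delta> b)} \<in> L_AB \<phi> \<psi>"
        using pb_closed_idealD(1)[OF M] by (intro ideal_pair_mem_L_AB) blast
      then have "x \<in> L_AB \<phi> \<psi>" by (simp add: x_def ideal_pair_def)
      moreover have "a \<in> I" "b \<in> J" using ab(1) by (auto simp: M_def IJ pair_ideal_def)
      then have "way_below pair_le (Lat \<times> Lat) x q"
        unfolding x_def IJ using ab(2,3) \<delta> by (rule way_below_Ideal_diff_truncate)
      ultimately have "x \<in> approximants q" by (simp add: approximants_def)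
      with u(2) have "pair_le x u" by (rule bspec)
      then show ?thesis
        using subset_Ideal[of "{a - truncate \<delta> a}"] subset_Ideal[of "{b - truncate \<delta> b}"]
        by (auto simp: pair_le_def x_def u0)
    qed
    then show ?thesis
      using mem_if_diff_truncate_mem[OF ideals(1) ab(2)] mem_if_diff_truncate_mem[OF ideals(2) ab(3)]
      by blast
  qed
  have "a \<in> I0 \<and> b \<in> J0" if ab: "(a, b) \<in> M" for a b
  proof -
    obtain a1 b1 a2 b2 where *: "(a1, b1) \<in> M" "(a2, b2) \<in> M"
      "star a1 = a1" "star b1 = b1" "star a2 = a2" "star b2 = b2"
      "a = a1 + scaleC \<i> a2" "b = b1 + scaleC \<i> b2"
      by (rule self_adjoint_parts[OF M' ab])
    then have "a1 \<in> I0" "b1 \<in> J0" "a2 \<in> I0" "b2 \<in> J0" using sa by auto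
    then show ?thesis
      unfolding *(7,8) by (intro conjI closed_idealD[OF ideals(1)] closed_idealD[OF ideals(2)])
  qed
  then have "fst ` M \<subseteq> I0" "snd ` M \<subseteq> J0" by auto
  then have "pair_le (ideal_pair M) u"
    using ideals by (simp add: pair_le_def ideal_pair_def u0 Ideal_least)
  then show ?thesis by (simp add: M_def ideal_pair_pair_ideal[OF q])
qed

lemma is_lub_approximants:
  assumes q: "q \<in> L_AB \<phi> \<psi>"
  shows "is_lub pair_le (L_AB \<phi> \<psi>) (approximants q) q"
proof -
  have "q \<in> Lat \<times> Lat" using q L_AB_subset by blast
  then have "\<forall>p\<in>approximants q. pair_le p q"
    using way_below_imp_le unfolding approximants_def by blast
  moreover have "pair_le q u" if "u \<in> L_AB \<phi> \<psi>" "\<forall>p\<in>approximants q. pair_le p u" for u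
    by (rule approximants_le[OF q subsetD[OF L_AB_subset that(1)] that(2)])
  ultimately show ?thesis using q unfolding is_lub_def by blast
qed

text \<open>Suprema in \<open>L_AB\<close> and \<open>Lat \<times> Lat\<close> agree, so the join of
  two approximants is again one; the supremum of the empty set shows that there is an
  approximant.\<close>

lemma directed_approximants: "directed_on (approximants q) pair_le"
  unfolding directed_on_def
proof (intro conjI ballI impI)
  have "\<exists>s. is_lub pair_le (L_AB \<phi> \<psi>) T s \<and> is_lub pair_le (Lat \<times> Lat) T s"
    if "T \<subseteq> L_AB \<phi> \<psi>" for T
    using is_lub_L_AB[OF that] is_lub_Lat_Times_Lat by blast
  note lub = this
  obtain z where z: "is_lub pair_le (L_AB \<phi> \<psi>) {} z" "is_lub pair_le (Lat \<times> Lat) {} z"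
    using lub[of "{}"] by auto
  have "way_below pair_le (Lat \<times> Lat) z q"
  proof (rule way_belowI)
    fix K :: "('a set \<times> 'b set) set" and r and f :: "_ \<Rightarrow> 'a set \<times> 'b set"
    assume "directed_on K r" "f ` K \<subseteq> Lat \<times> Lat"
    then obtain k where k: "k \<in> K" "f k \<in> Lat \<times> Lat" unfolding directed_on_def by blast
    have "pair_le z (f k)"
      using z(2)[unfolded is_lub_def, THEN conjunct2, THEN conjunct2, THEN bspec, OF k(2)] by simp
    with k(1) show "\<exists>j\<in>K. pair_le z (f j)" by (rule bexI[rotated])
  qed
  moreover have "z \<in> L_AB \<phi> \<psi>" using z(1) by (simp add: is_lub_def)
  ultimately have "z \<in> approximants q" by (simp add: approximants_def)
  then show "approximants q \<noteq> {}" by blast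
  show "\<exists>k\<in>approximants q. pair_le i k \<and> pair_le j k"
    if i: "i \<in> approximants q" and j: "j \<in> approximants q" for i j
  proof -
    obtain s where s: "is_lub pair_le (L_AB \<phi> \<psi>) {i, j} s" "is_lub pair_le (Lat \<times> Lat) {i, j} s"
      using lub[of "{i, j}"] i j by (auto simp: approximants_def)
    have "way_below pair_le (Lat \<times> Lat) s q"
      by (rule way_below_lub_pair[OF _ _ s(2)]) (use i j in \<open>simp_all add: approximants_def\<close>)
    then show ?thesis
      using s(1) by (intro bexI[of _ s]) (simp_all add: approximants_def is_lub_def)
  qed
qed (auto simp: pair_le_def)

text \<open>The approximants of \<open>q\<close>, indexed by themselves, form a net with supremum
  \<open>q\<close>. So any \<open>p\<close> way below \<open>q\<close> in \<open>L_AB\<close> lies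
  below an approximant \<open>j\<close>, and \<open>j\<close> is way below \<open>q\<close> in
  \<open>Lat \<times> Lat\<close>.\<close>

lemma way_below_L_AB_iff:
  assumes q: "q \<in> L_AB \<phi> \<psi>"
  shows "way_below pair_le (L_AB \<phi> \<psi>) p q \<longleftrightarrow> way_below pair_le (Lat \<times> Lat) p q"
proof
  assume wb: "way_below pair_le (L_AB \<phi> \<psi>) p q"
  have "\<exists>j\<in>approximants q. pair_le p (id j)"
    by (rule way_belowD[OF wb directed_approximants, where s = q])
      (use is_lub_approximants[OF q] in \<open>auto simp: approximants_def pair_le_def\<close>)
  then obtain j where j: "pair_le p j" "way_below pair_le (Lat \<times> Lat) j q"
    by (auto simp: approximants_def)
  show "way_below pair_le (Lat \<times> Lat) p q"
  proof (rule way_belowI)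
    fix K :: "('a set \<times> 'b set) set" and r f s
    assume net: "directed_on K r" "f ` K \<subseteq> Lat \<times> Lat" "\<forall>i\<in>K. \<forall>j\<in>K. r i j \<longrightarrow> pair_le (f i) (f j)"
      "is_lub pair_le (Lat \<times> Lat) (f ` K) s" "pair_le q s"
    from way_belowD[OF j(2) net] show "\<exists>j\<in>K. pair_le p (f j)"
      using pair_le_trans[OF j(1)] by blast
  qed
qed (rule way_below_L_AB_if)

end

theorem theorem2p7:
  fixes \<phi> :: "'a::cstar_algebra \<Rightarrow> 'c::cstar_algebra"
    and \<psi> :: "'b::cstar_algebra \<Rightarrow> 'c"
  assumes "star_hom \<phi>" and "star_hom \<psi>" and "surj \<phi>"
  defines "\<alpha> \<equiv> (\<lambda>M. (Ideal (fst ` M), Ideal (snd ` M)))"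
    and "\<beta> \<equiv> (\<lambda>(I, J). {(a, b) \<in> pullback \<phi> \<psi>. a \<in> I \<and> b \<in> J})"
  shows "continuous_lattice pair_le (L_AB \<phi> \<psi>)
       \<and> lattice_iso (\<subseteq>) (Lat_pb \<phi> \<psi>) pair_le (L_AB \<phi> \<psi>) \<alpha>
       \<and> (\<forall>M\<in>Lat_pb \<phi> \<psi>. \<beta> (\<alpha> M) = M)
       \<and> (\<forall>p\<in>L_AB \<phi> \<psi>. \<beta> p \<in> Lat_pb \<phi> \<psi> \<and> \<alpha> (\<beta> p) = p)
       \<and> (\<forall>T\<subseteq>L_AB \<phi> \<psi>. \<exists>s. is_lub pair_le (L_AB \<phi> \<psi>) T s
                              \<and> is_lub pair_le (Lat \<times> Lat) T s)
       \<and> (\<forall>p\<in>L_AB \<phi> \<psi>. \<forall>q\<in>L_AB \<phi> \<psi>.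
            way_below pair_le (L_AB \<phi> \<psi>) p q \<longleftrightarrow> way_below pair_le (Lat \<times> Lat) p q)"
proof -
  interpret pullback_diagram \<phi> \<psi> by unfold_locales (fact assms)+
  have \<alpha>: "\<alpha> = ideal_pair" by (simp add: \<alpha>_def ideal_pair_def fun_eq_iff)
  have \<beta>: "\<beta> = pair_ideal" by (simp add: \<beta>_def pair_ideal_def)
  have lub: "\<forall>T\<subseteq>L_AB \<phi> \<psi>. \<exists>s. is_lub pair_le (L_AB \<phi> \<psi>) T s \<and> is_lub pair_le (Lat \<times> Lat) T s"
    using is_lub_L_AB is_lub_Lat_Times_Lat by blast
  have "partial_order_on_set pair_le (L_AB \<phi> \<psi>)"
    by (auto simp: partial_order_on_set_def pair_le_def)
  \<comment> \<open>The equivalence of the two way-below relations reduces continuity to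
    \<open>is_lub_approximants\<close>.\<close>
  moreover have "{x' \<in> L_AB \<phi> \<psi>. way_below pair_le (L_AB \<phi> \<psi>) x' x} = approximants x"
    if "x \<in> L_AB \<phi> \<psi>" for x
    unfolding approximants_def by (simp only: way_below_L_AB_iff[OF that])
  moreover have "\<forall>T\<subseteq>L_AB \<phi> \<psi>. \<exists>s. is_lub pair_le (L_AB \<phi> \<psi>) T s"
    using lub by blast
  ultimately have "continuous_lattice pair_le (L_AB \<phi> \<psi>)"
    using is_lub_approximants unfolding continuous_lattice_def complete_lattice_on_def by simp
  moreover have "lattice_iso (\<subseteq>) (Lat_pb \<phi> \<psi>) pair_le (L_AB \<phi> \<psi>) \<alpha>"
    unfolding lattice_iso_def
  proof (intro conjI ballI)
    show "bij_betw \<alpha> (Lat_pb \<phi> \<psi>) (L_AB \<phi> \<psi>)"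
      unfolding \<alpha>
    proof (rule bij_betw_byWitness[where f' = pair_ideal])
      show "ideal_pair ` Lat_pb \<phi> \<psi> \<subseteq> L_AB \<phi> \<psi>"
        by (intro image_subsetI ideal_pair_mem_L_AB pb_closed_idealD(1))
      show "pair_ideal ` L_AB \<phi> \<psi> \<subseteq> Lat_pb \<phi> \<psi>"
        by (intro image_subsetI pair_ideal_mem_Lat_pb)
    qed (intro ballI pair_ideal_ideal_pair ideal_pair_pair_ideal, assumption)+
    fix M N assume M: "M \<in> Lat_pb \<phi> \<psi>" and N: "N \<in> Lat_pb \<phi> \<psi>"
    have "pair_le (\<alpha> M) (\<alpha> N)" if "M \<subseteq> N"
      using that by (simp add: \<alpha> pair_le_def ideal_pair_def Ideal_mono image_mono)
    \<comment> \<open>Applying \<open>pair_ideal\<close> recovers \<open>M\<close> and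
      \<open>N\<close>, so \<alpha> reflects the order.\<close>
    moreover have "pair_ideal (\<alpha> M) \<subseteq> pair_ideal (\<alpha> N)" if "pair_le (\<alpha> M) (\<alpha> N)"
      using that unfolding pair_le_def pair_ideal_def split_beta by blast
    ultimately show "M \<subseteq> N \<longleftrightarrow> pair_le (\<alpha> M) (\<alpha> N)"
      unfolding \<alpha> pair_ideal_ideal_pair[OF M] pair_ideal_ideal_pair[OF N] by blast
  qed
  ultimately show ?thesis
    by (intro conjI ballI lub)
      (simp_all add: \<alpha> \<beta> pair_ideal_ideal_pair ideal_pair_pair_ideal pair_ideal_mem_Lat_pb way_below_L_AB_iff)
qed

end
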